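(* Let $\Omega\subset\mathbb{R}^{n}$ be a domain containing the origin $0\in\mathbb{R}^{n}$, and let $f:\Omega\rightarrow\Omega$ be an analytic function. If $f$ satisfies the conditions $$f(0)=0\qquad\text{and}\qquad r(\partial_{0}f)<1,$$ where $\partial_{0}f$ is the matrix of the linearization of $f$ at $0$ and $r$ denotes the spectral radius, then $0$ is an asymptotically stable fixed point of the system $y_{k+1}=f(y_{k})$, $k=0,1,2,\dots$. The domain of attraction $DA(0)$ is an open subset of $\Omega$ and coincides with the natural domain of analyticity of the unique solution $V$ of the iterative first order functional equation $$\left\{\begin{array}{l} V(f(x))-V(x)=-\|x\|^{2}\\ V(0)=0.\end{array}\right.$$ The function $V$ is positive on $DA(0)$, and $V(x)\to+\infty$ as $x\to x^{0}$, for any $x^{0}\in Fr\,DA(0)$, where $Fr\,DA(0)$ denotes the boundary of $DA(0)$.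
   Context: $\|\cdot\|$ is the Euclidean norm on $\mathbb{R}^{n}$, and $f^{k}$ denotes the $k$-fold composition of $f$ with itself ($f^{0}=\mathrm{id}$). For $\varepsilon>0$ let $B(0,\varepsilon)=\{x\in\Omega : \|x\|<\varepsilon\}$. The fixed point $0$ of the system $y_{k+1}=f(y_{k})$ is stable if for any ball $B(0,\varepsilon)$ there is a ball $B(0,\delta)$ such that $x\in B(0,\delta)$ implies $f^{k}(x)\in B(0,\varepsilon)$ for $k=0,1,2,\dots$. It is asymptotically stable if in addition there is a ball $B(0,\rho)$ such that $f^{k}(x)\to 0$ as $k\to\infty$ for all $x\in B(0,\rho)$. The domain of attraction of the asymptotically stable fixed point $0$ is $DA(0)=\{x\in\Omega : f^{k}(x)\to 0 \text{ as } k\to\infty\}$. The natural domain of analyticity of a function is understood in the usual sense, as the maximal domain on which the function is analytic.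
   Formalization: The boundary Fr DA(0) and the natural domain of analyticity are taken within Ω (the claim fails for Ω=(-1,1), f(x)=x/2); V is unique among solutions continuous at 0, and positive on DA(0) except at 0, where V(0)=0. *)

theory Defs
  imports "HOL-Analysis.Analysis"
begin

text \<open>
  Real analyticity in several variables. The multi-indices are the functions from the
  coordinates to \<^typ>\<open>nat\<close>, and the power series converges unconditionally (for finite-dimensional
  values: absolutely) at every point of a ball around the centre.
\<close>

definition real_analytic_at :: "(real ^ 'n \<Rightarrow> 'b::real_normed_vector) \<Rightarrow> real ^ 'n \<Rightarrow> bool" where
  "real_analytic_at g a \<longleftrightarrow>
     (\<exists>r>0. \<exists>c :: ('n \<Rightarrow> nat) \<Rightarrow> 'b. \<forall>x\<in>ball a r.
        ((\<lambda>\<alpha>. (\<Prod>i\<in>UNIV. (x $ i - a $ i) ^ \<alpha> i) *\<^sub>R c \<alpha>) has_sum g x) UNIV)"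

definition real_analytic_on :: "(real ^ 'n \<Rightarrow> 'b::real_normed_vector) \<Rightarrow> (real ^ 'n) set \<Rightarrow> bool" where
  "real_analytic_on g S \<longleftrightarrow> (\<forall>a\<in>S. real_analytic_at g a)"

text \<open>
  The complex eigenvalues of a real square matrix. This set is finite and nonempty, so the
  maximum below is attained.
\<close>

definition complex_eigenvalues :: "real ^ 'n ^ 'n \<Rightarrow> complex set" where
  "complex_eigenvalues A =
     {k. \<exists>v :: complex ^ 'n. v \<noteq> 0 \<and> (\<chi> i j. complex_of_real (A $ i $ j)) *v v = k *s v}"

definition matrix_spectral_radius :: "real ^ 'n ^ 'n \<Rightarrow> real" where
  "matrix_spectral_radius A = Max (norm ` complex_eigenvalues A)"

definition zero_ball :: "(real ^ 'n) set \<Rightarrow> real \<Rightarrow> (real ^ 'n) set" where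
  "zero_ball \<Omega> e = {x \<in> \<Omega>. norm x < e}"

definition stable_at_zero :: "(real ^ 'n) set \<Rightarrow> (real ^ 'n \<Rightarrow> real ^ 'n) \<Rightarrow> bool" where
  "stable_at_zero \<Omega> f \<longleftrightarrow>
     (\<forall>e>0. \<exists>d>0. \<forall>x \<in> zero_ball \<Omega> d. \<forall>k. (f ^^ k) x \<in> zero_ball \<Omega> e)"

definition asymptotically_stable_at_zero ::
    "(real ^ 'n) set \<Rightarrow> (real ^ 'n \<Rightarrow> real ^ 'n) \<Rightarrow> bool" where
  "asymptotically_stable_at_zero \<Omega> f \<longleftrightarrow>
     stable_at_zero \<Omega> f \<and>
     (\<exists>\<rho>>0. \<forall>x \<in> zero_ball \<Omega> \<rho>. (\<lambda>k. (f ^^ k) x) \<longlonglongrightarrow> 0)"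

definition domain_of_attraction ::
    "(real ^ 'n) set \<Rightarrow> (real ^ 'n \<Rightarrow> real ^ 'n) \<Rightarrow> (real ^ 'n) set" where
  "domain_of_attraction \<Omega> f = {x \<in> \<Omega>. (\<lambda>k. (f ^^ k) x) \<longlonglongrightarrow> 0}"

text \<open>
  \<open>V\<close> solves the functional equation on \<open>D\<close>. Forward invariance of \<open>D\<close> guarantees that the
  equation only involves values of \<open>V\<close> on \<open>D\<close>.
\<close>

definition solves_functional_equation ::
    "(real ^ 'n \<Rightarrow> real ^ 'n) \<Rightarrow> (real ^ 'n) set \<Rightarrow> (real ^ 'n \<Rightarrow> real) \<Rightarrow> bool" where
  "solves_functional_equation f D V \<longleftrightarrow>
     0 \<in> D \<and> f ` D \<subseteq> D \<and>
     (\<forall>x\<in>D. V (f x) - V x = - (norm x)\<^sup>2) \<and> V 0 = 0"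

text \<open>
  \<open>D\<close> is the natural domain of analyticity, within \<open>\<Omega>\<close>, of the function \<open>V\<close> given on \<open>D\<close>: \<open>V\<close> is
  analytic on the open set \<open>D\<close>, and analytic continuation of \<open>V\<close>, from any nonempty open piece
  of \<open>D\<close> to a connected open subset of \<open>\<Omega>\<close>, never leaves \<open>D\<close>. Connectedness of \<open>D\<close> is not required,
  since a domain of attraction can have several components.
\<close>

definition natural_domain_of_analyticity ::
    "(real ^ 'n) set \<Rightarrow> (real ^ 'n \<Rightarrow> real) \<Rightarrow> (real ^ 'n) set \<Rightarrow> bool" where
  "natural_domain_of_analyticity \<Omega> V D \<longleftrightarrow>
     open D \<and> D \<subseteq> \<Omega> \<and> real_analytic_on V D \<and>
     (\<forall>U N W. open U \<and> connected U \<and> U \<subseteq> \<Omega> \<and>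
        open N \<and> N \<noteq> {} \<and> N \<subseteq> U \<inter> D \<and>
        real_analytic_on W U \<and> (\<forall>x\<in>N. W x = V x) \<longrightarrow> U \<subseteq> D)"

end

theory Submission
  imports Defs "HOL-Computational_Algebra.Fundamental_Theorem_Algebra"
begin

text \<open>
  The solution of the functional equation is \<open>V x = (\<Sum>k. \<parallel>f\<^sup>k x\<parallel>\<^sup>2)\<close>: iterating the equation along the
  orbit of \<open>x\<close> telescopes, and the remainder \<open>V (f\<^sup>k x)\<close> tends to \<open>V 0 = 0\<close> when the orbit tends to \<open>0\<close>
  and \<open>V\<close> is continuous there. This gives uniqueness and positivity. What takes work is convergence,
  analyticity and the behaviour at the boundary.

  Analyticity is handled without complexification, by a majorant calculus. The relation
  \<open>majorized a r M g\<close> says that \<open>g\<close> is the sum of a power series at \<open>a\<close> on the closed cube of radius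
  \<open>r\<close> and that the weighted \<open>\<ell>\<^sup>1\<close> norm of its coefficients, with weights \<open>r\<close> to the degree, is at
  most \<open>M\<close>. These norms make power series a Banach algebra: products multiply the bounds
  (\<open>majorized_mult\<close>), series of functions add them (\<open>majorized_infsum\<close>), and hence composition
  preserves them (\<open>majorized_compose\<close>). Every interior point of the cube is again a centre of
  expansion, since re-expansion is composition with a translation (\<open>majorized_recenter\<close>). If \<open>g\<close>
  vanishes at \<open>a\<close>, then the bound shrinks in proportion to the radius (\<open>majorized_schwarz\<close>), a
  substitute for the Schwarz lemma.

  Let \<open>A\<close> be the Jacobian matrix at \<open>0\<close>. Since its spectral radius is less than one, \<open>A\<^sup>k v\<close> tends to
  \<open>0\<close> for every \<open>v\<close> (\<open>matrix_powers_tendsto_zero\<close>), so some iterate \<open>f\<^sup>m\<close> has a small linear part. Its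
  higher order part is quadratically small, so the components of \<open>f\<^sup>m\<close> on the cube of radius \<open>s\<close> are
  majorized by \<open>s / 2\<close> for all small \<open>s\<close>. Composing, one gets for all iterates a bound
  \<open>C * q\<^sup>k * s\<close> with \<open>q < 1\<close> in the majorant norm (\<open>iterate_majorized\<close>). This single estimate yields
  asymptotic stability and, after squaring and summing, a convergent power series for \<open>V\<close> at \<open>0\<close>.
  Elsewhere in the domain of attraction \<open>V\<close> is analytic because
  \<open>V x = V (f\<^sup>m x) + (\<Sum>k<m. \<parallel>f\<^sup>k x\<parallel>\<^sup>2)\<close> and \<open>f\<^sup>m x\<close> is close to \<open>0\<close> for suitable \<open>m\<close>.

  The orbit of a boundary point \<open>x\<^sub>0 \<in> \<Omega>\<close> never enters a fixed ball that lies in the domain of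
  attraction, so each of the continuous terms \<open>\<parallel>f\<^sup>k x\<parallel>\<^sup>2\<close> is bounded below near \<open>x\<^sub>0\<close>, and arbitrarily
  many of them force \<open>V\<close> to infinity (\<open>V_tendsto_infinity\<close>). Therefore an analytic continuation of \<open>V\<close>
  to a connected set \<open>U \<subseteq> \<Omega>\<close> cannot cross the boundary: by the identity theorem
  (\<open>real_analytic_on_eq_zero\<close>) it agrees with \<open>V\<close> on a component of the part of \<open>U\<close> in the domain of
  attraction, and at a boundary point of that component inside \<open>U\<close> it would be both finite and
  infinite.
\<close>

section \<open>Powers of a matrix of spectral radius less than one\<close>

text \<open>
  Once the perturbation is below \<open>(1 - \<bar>l\<bar>) * \<epsilon> / 2\<close>, the bound \<open>\<epsilon> / 2\<close> reproduces itself and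
  the excess over it decays geometrically.
\<close>

lemma tendsto_zero_perturbed_contraction:
  fixes u e :: "nat \<Rightarrow> complex"
  assumes rec: "\<And>k. u (Suc k) = l * u k + e k" and l: "norm l < 1" and e: "e \<longlonglongrightarrow> 0"
  shows "u \<longlonglongrightarrow> 0"
proof (rule LIMSEQ_I)
  fix \<epsilon> :: real assume "0 < \<epsilon>"
  then have "0 < (1 - norm l) * (\<epsilon> / 2)" using l by simp
  then obtain K where K: "\<And>k. k \<ge> K \<Longrightarrow> norm (e k) < (1 - norm l) * (\<epsilon> / 2)"
    using LIMSEQ_D[OF e] by (metis diff_zero)
  have step: "norm (u (K + j)) \<le> norm l ^ j * norm (u K) + \<epsilon> / 2" for j
  proof (induction j)
    case (Suc j)
    have "norm (u (K + Suc j)) \<le> norm l * norm (u (K + j)) + norm (e (K + j))"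
      using norm_triangle_ineq[of "l * u (K + j)" "e (K + j)"] by (simp add: rec norm_mult)
    also have "\<dots> \<le> norm l * (norm l ^ j * norm (u K) + \<epsilon> / 2) + (1 - norm l) * (\<epsilon> / 2)"
      using K[of "K + j"] Suc by (intro add_mono mult_left_mono) auto
    finally show ?case by (simp add: algebra_simps diff_divide_distrib)
  qed (use \<open>0 < \<epsilon>\<close> in simp)
  have "(\<lambda>j. norm l ^ j * norm (u K)) \<longlonglongrightarrow> 0"
    using l by (intro tendsto_mult_left_zero LIMSEQ_power_zero) auto
  then obtain J where J: "\<And>j. j \<ge> J \<Longrightarrow> norm (norm l ^ j * norm (u K)) < \<epsilon> / 2"
    using LIMSEQ_D[of _ 0 "\<epsilon> / 2"] \<open>0 < \<epsilon>\<close> by fastforce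
  show "\<exists>N. \<forall>k\<ge>N. norm (u k - 0) < \<epsilon>"
  proof (intro exI[of _ "K + J"] allI impI)
    fix k assume "k \<ge> K + J"
    then obtain j where "k = K + j" "j \<ge> J"
      by (metis add.assoc add_left_cancel le_Suc_ex le_add1)
    then show "norm (u k - 0) < \<epsilon>" using step[of j] J[of j] by auto
  qed
qed

text \<open>
  The vector \<open>p(A) v\<close>, written with iterates of the linear map so that no matrix powers occur.
\<close>

definition poly_action :: "complex poly \<Rightarrow> complex ^ 'n ^ 'n \<Rightarrow> complex ^ 'n \<Rightarrow> complex ^ 'n" where
  "poly_action p A v = (\<Sum>k\<le>degree p. coeff p k *s (((*v) A) ^^ k) v)"

lemma poly_action_upto:
  assumes "degree p \<le> N"
  shows "poly_action p A v = (\<Sum>k\<le>N. coeff p k *s (((*v) A) ^^ k) v)"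
  unfolding poly_action_def using assms
  by (intro sum.mono_neutral_left) (auto simp: coeff_eq_0)

lemma matrix_pow_add:
  fixes A :: "complex ^ 'n ^ 'n"
  shows "((*v) A ^^ k) (x + y) = ((*v) A ^^ k) x + ((*v) A ^^ k) y"
  by (induction k) (auto simp: matrix_vector_right_distrib)

lemma matrix_pow_scale:
  fixes A :: "complex ^ 'n ^ 'n"
  shows "((*v) A ^^ k) (c *s x) = c *s ((*v) A ^^ k) x"
  by (induction k) (auto simp: vector_scalar_commute)

lemma poly_action_linear_factor_right:
  "poly_action ([:- l, 1:] * q) A v = poly_action q A (A *v v - l *s v)"
proof -
  define N where "N = degree q"
  have "degree ([:- l, 1:] * q) \<le> Suc N"
    using degree_mult_le[of "[:- l, 1:]" q] by (simp add: N_def)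
  then have "poly_action ([:- l, 1:] * q) A v =
      (\<Sum>k\<le>Suc N. coeff ([:- l, 1:] * q) k *s (((*v) A) ^^ k) v)"
    by (rule poly_action_upto)
  also have "\<dots> = (\<Sum>k\<le>Suc N. coeff (pCons 0 q) k *s (((*v) A) ^^ k) v)
                - (\<Sum>k\<le>Suc N. (l * coeff q k) *s (((*v) A) ^^ k) v)"
    unfolding sum_subtractf[symmetric] by (rule sum.cong) (auto simp: vec_eq_iff algebra_simps)
  also have "(\<Sum>k\<le>Suc N. coeff (pCons 0 q) k *s (((*v) A) ^^ k) v) =
      (\<Sum>k\<le>N. coeff q k *s (((*v) A) ^^ k) (A *v v))"
    by (subst sum.atMost_Suc_shift) (simp add: funpow_swap1)
  also have "(\<Sum>k\<le>Suc N. (l * coeff q k) *s (((*v) A) ^^ k) v) =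
      (\<Sum>k\<le>N. (l * coeff q k) *s (((*v) A) ^^ k) v)"
    by (simp add: N_def coeff_eq_0)
  also have "(\<Sum>k\<le>N. coeff q k *s (((*v) A) ^^ k) (A *v v)) - \<dots> =
      (\<Sum>k\<le>N. coeff q k *s (((*v) A) ^^ k) (A *v v + (- l) *s v))"
    unfolding matrix_pow_add matrix_pow_scale
    by (simp add: sum_subtractf[symmetric] vec_eq_iff algebra_simps)
  also have "A *v v + (- l) *s v = A *v v - l *s v"
    by (simp add: vec_eq_iff)
  finally show ?thesis by (simp add: poly_action_def N_def)
qed

lemma poly_action_diff: "poly_action p A (x - y) = poly_action p A x - poly_action p A y"
proof -
  have "((*v) A ^^ k) (x - y) = ((*v) A ^^ k) x - ((*v) A ^^ k) y" for k
    by (induction k) (auto simp: matrix_vector_mult_diff_distrib)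
  then show ?thesis
    by (simp only: poly_action_def) (simp add: sum_subtractf[symmetric] vec_eq_iff right_diff_distrib)
qed

lemma poly_action_scale: "poly_action p A (c *s x) = c *s poly_action p A x"
  by (simp add: poly_action_def matrix_pow_scale vec_eq_iff sum_distrib_left algebra_simps)

lemma poly_action_commute: "poly_action p A (A *v x) = A *v poly_action p A x"
proof -
  have "A *v (\<Sum>k\<in>K. g k) = (\<Sum>k\<in>K. A *v g k)" for K and g :: "nat \<Rightarrow> complex ^ 'a"
    by (induction K rule: infinite_finite_induct) (auto simp: matrix_vector_right_distrib)
  then show ?thesis
    by (simp add: poly_action_def funpow_swap1 vector_scalar_commute)
qed

lemma poly_action_linear_factor_left:
  "poly_action ([:- l, 1:] * q) A v = A *v poly_action q A v - l *s poly_action q A v"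
  by (simp only: poly_action_linear_factor_right poly_action_diff poly_action_scale poly_action_commute)

lemma poly_action_eigenvector:
  assumes "A *v v = l *s v"
  shows "poly_action p A v = poly p l *s v"
proof -
  have "((*v) A ^^ k) v = l ^ k *s v" for k
    by (induction k) (auto simp: vector_scalar_commute assms)
  then show ?thesis
    by (simp add: poly_action_def poly_altdef vec_eq_iff sum_distrib_right mult.assoc)
qed

text \<open>
  By induction on the degree of the annihilating polynomial. Split off a root \<open>l\<close>, leaving a
  cofactor \<open>q\<close>. If \<open>q\<close> annihilates \<open>v\<close>, the induction hypothesis applies to \<open>v\<close>. Otherwise \<open>q(A) v\<close> is an
  eigenvector, so that \<open>\<bar>l\<bar> < 1\<close>; the induction hypothesis applies to \<open>(A - l) v\<close>, and the
  iterates of \<open>v\<close> satisfy the recursion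
  \<open>A\<^sup>k\<^sup>+\<^sup>1 v = l A\<^sup>k v + A\<^sup>k (A - l) v\<close> of a perturbed contraction. This replaces a Jordan normal form.
\<close>

lemma matrix_powers_tendsto_zero_of_annihilator:
  fixes A :: "complex ^ 'n ^ 'n"
  assumes eig: "\<And>l w. w \<noteq> 0 \<Longrightarrow> A *v w = l *s w \<Longrightarrow> norm l < 1"
    and "p \<noteq> 0" "poly_action p A v = 0"
  shows "(\<lambda>k. ((*v) A ^^ k) v) \<longlonglongrightarrow> 0"
  using assms(2,3)
proof (induction "degree p" arbitrary: p v)
  case 0
  then obtain c where "p = [:c:]" "c \<noteq> 0" by (metis degree_eq_zeroE pCons_0_0)
  then have "v = 0" using 0 by (simp add: poly_action_def)
  moreover have "((*v) A ^^ k) 0 = 0" for k by (induction k) auto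
  ultimately show ?case by simp
next
  case (Suc d)
  then have "\<not> constant (poly p)" by (simp add: constant_degree)
  then obtain l where "poly p l = 0" using fundamental_theorem_of_algebra by blast
  then obtain q where p: "p = [:- l, 1:] * q" by (auto simp: poly_eq_0_iff_dvd dvd_def)
  with Suc have q: "q \<noteq> 0" by auto
  then have deg: "d = degree q" using Suc(2) unfolding p by (subst (asm) degree_mult_eq) auto
  show ?case
  proof (cases "poly_action q A v = 0")
    case True
    then show ?thesis using Suc(1)[OF deg q] by blast
  next
    case False
    have "A *v poly_action q A v = l *s poly_action q A v"
      using Suc(4) unfolding p poly_action_linear_factor_left by simp
    then have l: "norm l < 1" using eig False by blast
    let ?w = "A *v v - l *s v"
    have w: "(\<lambda>k. ((*v) A ^^ k) ?w) \<longlonglongrightarrow> 0"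
      using Suc(1)[OF deg q] Suc(4) unfolding p poly_action_linear_factor_right by blast
    have rec: "((*v) A ^^ Suc k) v = l *s ((*v) A ^^ k) v + ((*v) A ^^ k) ?w" for k
    proof -
      have "A *v v = l *s v + ?w" by simp
      then have "((*v) A ^^ k) (A *v v) = ((*v) A ^^ k) (l *s v) + ((*v) A ^^ k) ?w"
        by (metis matrix_pow_add)
      then show ?thesis by (simp add: matrix_pow_scale funpow_swap1)
    qed
    have "(\<lambda>k. ((*v) A ^^ k) v $ i) \<longlonglongrightarrow> 0" for i
    proof (rule tendsto_zero_perturbed_contraction[OF _ l])
      show "((*v) A ^^ Suc k) v $ i = l * ((*v) A ^^ k) v $ i + ((*v) A ^^ k) ?w $ i" for k
        unfolding rec by simp
      show "(\<lambda>k. ((*v) A ^^ k) ?w $ i) \<longlonglongrightarrow> 0"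
        using tendsto_vec_nth[OF w, of i] by simp
    qed
    then show ?thesis by (intro vec_tendstoI) simp
  qed
qed

definition complexify :: "real ^ 'n \<Rightarrow> complex ^ 'n" where
  "complexify v = (\<chi> i. complex_of_real (v $ i))"

abbreviation complexify_matrix :: "real ^ 'n ^ 'n \<Rightarrow> complex ^ 'n ^ 'n" where
  "complexify_matrix A \<equiv> (\<chi> i j. complex_of_real (A $ i $ j))"

lemma complexify_matrix_pow:
  "((*v) (complexify_matrix A) ^^ k) (complexify v) = complexify (((*v) A ^^ k) v)"
  by (induction k) (auto simp: complexify_def matrix_vector_mult_def vec_eq_iff)

text \<open>
  The powers of \<open>A\<close> live in a finite-dimensional space, so finitely many of them are linearly
  dependent.
\<close>

lemma matrix_annihilating_polynomial:
  fixes A :: "real ^ 'n ^ 'n"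
  obtains p where "p \<noteq> 0" "\<And>v. poly_action p (complexify_matrix A) v = 0"
proof -
  define P where "P k = ((**) A ^^ k) (mat 1)" for k
  define N where "N = DIM(real ^ 'n ^ 'n)"
  obtain u where u0: "\<exists>k\<le>N. u k \<noteq> 0" and u: "(\<Sum>k\<le>N. u k *\<^sub>R P k) = 0"
  \<comment> \<open>Linear dependence speaks of a set of matrices, so coinciding powers are treated separately.\<close>
  proof (cases "inj_on P {..N}")
    case True
    then have "card (P ` {..N}) > N" by (simp add: card_image)
    then have "dependent (P ` {..N})"
      unfolding N_def by (intro dependent_biggerset) auto
    then obtain w where w: "\<exists>v\<in>P ` {..N}. w v \<noteq> 0" "(\<Sum>v\<in>P ` {..N}. w v *\<^sub>R v) = 0"
      by (auto simp: dependent_finite)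
    show ?thesis
      by (rule that[of "w \<circ> P"]) (use w True in \<open>auto simp: sum.reindex\<close>)
  next
    case False
    then obtain i j where ij: "i \<le> N" "j \<le> N" "i \<noteq> j" "P i = P j"
      by (auto simp: inj_on_def)
    have "(\<Sum>k\<le>N. (if k = i then 1 else if k = j then -1 else 0) *\<^sub>R P k) =
        (\<Sum>k\<in>{i, j}. (if k = i then 1 else if k = j then -1 else 0) *\<^sub>R P k)"
      using ij by (intro sum.mono_neutral_right) auto
    also have "\<dots> = 0" using ij by simp
    finally show ?thesis
      using ij by (intro that[of "\<lambda>k. if k = i then 1 else if k = j then -1 else 0"]) auto
  qed
  define p where "p = (\<Sum>k\<le>N. monom (complex_of_real (u k)) k)"
  have cp: "coeff p k = (if k \<le> N then complex_of_real (u k) else 0)" for k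
    by (simp add: p_def coeff_sum)
  have "p \<noteq> 0" using u0 cp by (metis coeff_0 of_real_eq_0_iff)
  moreover have "poly_action p (complexify_matrix A) v = 0" for v
  proof -
    have P: "((*v) (complexify_matrix A) ^^ k) v = complexify_matrix (P k) *v v" for k
    proof (induction k)
      case 0
      have "complexify_matrix (mat 1 :: real ^ 'n ^ 'n) = mat 1"
        by (simp add: mat_def vec_eq_iff)
      then show ?case by (simp add: P_def)
    next
      case (Suc k)
      have "complexify_matrix A ** complexify_matrix (P k) = complexify_matrix (A ** P k)"
        by (simp add: matrix_matrix_mult_def vec_eq_iff)
      then show ?case using Suc by (simp add: P_def matrix_vector_mul_assoc)
    qed
    have "degree p \<le> N" by (rule degree_le) (simp add: cp)
    then have "poly_action p (complexify_matrix A) v =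
        (\<Sum>k\<le>N. complex_of_real (u k) *s (complexify_matrix (P k) *v v))"
      by (simp add: poly_action_upto P cp)
    also have "\<dots> = complexify_matrix (\<Sum>k\<le>N. u k *\<^sub>R P k) *v v"
    proof -
      have "(\<Sum>k\<le>N. complex_of_real (u k) *s (complexify_matrix (P k) *v v)) $ i =
          (complexify_matrix (\<Sum>k\<le>N. u k *\<^sub>R P k) *v v) $ i" for i
        by (simp add: matrix_vector_mult_def sum_distrib_left sum_distrib_right mult.assoc)
           (rule sum.swap)
      then show ?thesis by (simp add: vec_eq_iff)
    qed
    also have "\<dots> = 0" unfolding u by (simp add: matrix_vector_mult_def vec_eq_iff)
    finally show ?thesis .
  qed
  ultimately show ?thesis using that by blast
qed

text \<open>
  The annihilating polynomial serves twice: its roots contain all eigenvalues, which therefore form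
  a finite set whose maximal modulus is attained, and it feeds the preceding induction.
\<close>

lemma matrix_powers_tendsto_zero:
  fixes A :: "real ^ 'n ^ 'n"
  assumes "matrix_spectral_radius A < 1"
  shows "(\<lambda>k. ((*v) A ^^ k) v) \<longlonglongrightarrow> 0"
proof -
  obtain p where p: "p \<noteq> 0" "\<And>v. poly_action p (complexify_matrix A) v = 0"
    using matrix_annihilating_polynomial by blast
  have "complex_eigenvalues A \<subseteq> {l. poly p l = 0}"
  proof
    fix l assume "l \<in> complex_eigenvalues A"
    then obtain w where "w \<noteq> 0" "complexify_matrix A *v w = l *s w"
      by (auto simp: complex_eigenvalues_def)
    then show "l \<in> {l. poly p l = 0}"
      using poly_action_eigenvector[of "complexify_matrix A" w l p] p(2) by simp
  qed
  then have fin: "finite (norm ` complex_eigenvalues A)"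
    using poly_roots_finite[OF p(1)] finite_subset by blast
  have eig: "norm l < 1" if "w \<noteq> 0" "complexify_matrix A *v w = l *s w" for l w
  proof -
    have "l \<in> complex_eigenvalues A" using that by (auto simp: complex_eigenvalues_def)
    then have "norm l \<le> matrix_spectral_radius A"
      unfolding matrix_spectral_radius_def using fin by (intro Max_ge) auto
    then show ?thesis using assms by simp
  qed
  from matrix_powers_tendsto_zero_of_annihilator[OF eig p(1) p(2)[of "complexify v"]]
  have lim: "(\<lambda>k. complexify (((*v) A ^^ k) v)) \<longlonglongrightarrow> 0" by (simp only: complexify_matrix_pow)
  have "(\<lambda>k. ((*v) A ^^ k) v $ i) \<longlonglongrightarrow> 0" for i
    using tendsto_vec_nth[OF lim, of i] tendsto_of_real_iff[where c="0::real"]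
    by (fastforce simp: complexify_def)
  then show ?thesis by (intro vec_tendstoI) simp
qed

section \<open>Power series with absolutely summable coefficients on a cube\<close>

definition multi_power :: "real ^ 'n \<Rightarrow> ('n \<Rightarrow> nat) \<Rightarrow> real" where
  "multi_power y \<alpha> = (\<Prod>i\<in>UNIV. (y $ i) ^ \<alpha> i)"

definition total_degree :: "('n::finite \<Rightarrow> nat) \<Rightarrow> nat" where
  "total_degree \<alpha> = (\<Sum>i\<in>UNIV. \<alpha> i)"

text \<open>
  The closed ball of the maximum norm, on which every monomial is dominated by its value at a
  corner.
\<close>

definition cube :: "real ^ 'n \<Rightarrow> real \<Rightarrow> (real ^ 'n) set" where
  "cube a r = {x. \<forall>i. \<bar>x $ i - a $ i\<bar> \<le> r}"

lemma cubeI: "(\<And>i. \<bar>x $ i - a $ i\<bar> \<le> r) \<Longrightarrow> x \<in> cube a r"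
  by (simp add: cube_def)

lemma cubeD: "x \<in> cube a r \<Longrightarrow> \<bar>x $ i - a $ i\<bar> \<le> r"
  by (simp add: cube_def)

lemma cube_mono: "r \<le> s \<Longrightarrow> cube a r \<subseteq> cube a s"
  by (auto simp: cube_def intro: order_trans)

lemma centre_in_cube: "0 \<le> r \<Longrightarrow> a \<in> cube a r"
  by (simp add: cube_def)

lemma cball_subset_cube: "cball a r \<subseteq> cube a r"
proof
  fix x assume "x \<in> cball a r"
  then have "norm (x - a) \<le> r" by (simp add: dist_norm norm_minus_commute)
  then show "x \<in> cube a r"
    by (intro cubeI) (metis component_le_norm_cart order_trans vector_minus_component)
qed

lemma multi_power_add: "multi_power y (\<lambda>i. \<alpha> i + \<beta> i) = multi_power y \<alpha> * multi_power y \<beta>"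
  by (simp add: multi_power_def power_add prod.distrib)

lemma total_degree_add: "total_degree (\<lambda>i. \<alpha> i + \<beta> i) = total_degree \<alpha> + total_degree \<beta>"
  by (simp add: total_degree_def sum.distrib)

lemma abs_multi_power_le:
  assumes "\<And>i. \<bar>y $ i\<bar> \<le> r"
  shows "\<bar>multi_power y \<alpha>\<bar> \<le> r ^ total_degree \<alpha>"
proof -
  have "\<bar>multi_power y \<alpha>\<bar> = (\<Prod>i\<in>UNIV. \<bar>y $ i\<bar> ^ \<alpha> i)"
    by (simp add: multi_power_def abs_prod power_abs)
  also have "\<dots> \<le> (\<Prod>i\<in>UNIV. r ^ \<alpha> i)"
    by (intro prod_mono conjI power_mono assms) auto
  also have "\<dots> = r ^ total_degree \<alpha>"
    by (simp add: total_degree_def power_sum)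
  finally show ?thesis .
qed

lemma multi_power_scale: "multi_power (t *\<^sub>R y) \<alpha> = t ^ total_degree \<alpha> * multi_power y \<alpha>"
  by (simp add: multi_power_def total_degree_def power_mult_distrib prod.distrib power_sum)

text \<open>
  The first infinite sum is the weighted \<open>\<ell>\<^sup>1\<close> norm of the coefficients; its finiteness makes the series
  for \<open>g\<close> converge absolutely and uniformly on the cube.
\<close>

definition has_expansion ::
    "(('n \<Rightarrow> nat) \<Rightarrow> real) \<Rightarrow> real ^ 'n \<Rightarrow> real \<Rightarrow> real \<Rightarrow> (real ^ 'n \<Rightarrow> real) \<Rightarrow> bool" where
  "has_expansion c a r M g \<longleftrightarrow> 0 < r \<and>
     (\<exists>S\<le>M. ((\<lambda>\<alpha>. \<bar>c \<alpha>\<bar> * r ^ total_degree \<alpha>) has_sum S) UNIV) \<and>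
     (\<forall>x\<in>cube a r. ((\<lambda>\<alpha>. c \<alpha> * multi_power (x - a) \<alpha>) has_sum g x) UNIV)"

definition majorized :: "real ^ 'n \<Rightarrow> real \<Rightarrow> real \<Rightarrow> (real ^ 'n \<Rightarrow> real) \<Rightarrow> bool" where
  "majorized a r M g \<longleftrightarrow> (\<exists>c. has_expansion c a r M g)"

lemma abs_term_le:
  assumes "x \<in> cube a r"
  shows "\<bar>b * multi_power (x - a) \<alpha>\<bar> \<le> \<bar>b\<bar> * r ^ total_degree \<alpha>"
  using abs_multi_power_le[of "x - a" r \<alpha>] cubeD[OF assms]
  by (auto simp: abs_mult intro: mult_left_mono)

lemma summable_abs_bound:
  fixes f h :: "'a \<Rightarrow> real"
  assumes "(h has_sum S) I" "\<And>t. t \<in> I \<Longrightarrow> \<bar>f t\<bar> \<le> h t"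
  shows "f summable_on I" "\<bar>infsum f I\<bar> \<le> S"
proof -
  have abs: "(\<lambda>t. \<bar>f t\<bar>) summable_on I"
    by (rule summable_on_comparison_test[OF has_sum_imp_summable[OF assms(1)]]) (use assms(2) in auto)
  then show "f summable_on I"
    using summable_on_iff_abs_summable_on_real by fastforce
  have "\<bar>infsum f I\<bar> \<le> infsum (\<lambda>t. \<bar>f t\<bar>) I"
    using norm_infsum_bound[of f I] abs by simp
  also have "\<dots> \<le> infsum h I"
    by (rule infsum_mono[OF abs has_sum_imp_summable[OF assms(1)]]) (use assms(2) in auto)
  finally show "\<bar>infsum f I\<bar> \<le> S"
    using assms infsumI by blast
qed

lemma has_sum_regroup:
  fixes f :: "'t \<Rightarrow> real" and e :: "'t \<Rightarrow> 'j"
  assumes "(f has_sum S) I"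
  shows "((\<lambda>\<gamma>. infsum f {t \<in> I. e t = \<gamma>}) has_sum S) UNIV"
proof -
  have bij: "bij_betw snd (SIGMA \<gamma>:UNIV. {t \<in> I. e t = \<gamma>}) I"
    by (auto simp: bij_betw_def inj_on_def image_iff)
  from has_sum_reindex_bij_betw[OF bij, THEN iffD2, OF assms] show ?thesis
  proof (rule has_sum_SigmaD)
    fix \<gamma>
    have "f summable_on {t \<in> I. e t = \<gamma>}"
      by (rule summable_on_subset_banach[OF has_sum_imp_summable[OF assms]]) auto
    then show "((\<lambda>t. f (snd (\<gamma>, t))) has_sum infsum f {t \<in> I. e t = \<gamma>}) {t \<in> I. e t = \<gamma>}"
      by simp
  qed
qed

text \<open>
  Series in which the same monomial occurs repeatedly, indexed by an arbitrary set, arise from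
  products and from series of power series. Collecting the coefficients of equal monomials is
  allowed by absolute convergence and can only decrease the norm. The closure under products and
  under series reduces to this.
\<close>

lemma majorized_of_monomial_family:
  fixes b :: "'t \<Rightarrow> real" and e :: "'t \<Rightarrow> 'n::finite \<Rightarrow> nat"
  assumes r: "0 < r"
    and abs: "((\<lambda>t. \<bar>b t\<bar> * r ^ total_degree (e t)) has_sum S) I" and S: "S \<le> M"
    and g: "\<And>x. x \<in> cube a r \<Longrightarrow> ((\<lambda>t. b t * multi_power (x - a) (e t)) has_sum g x) I"
  shows "majorized a r M g"
proof -
  define F where "F \<gamma> = {t \<in> I. e t = \<gamma>}" for \<gamma>
  define c where "c \<gamma> = infsum b (F \<gamma>)" for \<gamma>
  have pull_out: "infsum (\<lambda>t. h t * k (e t)) (F \<gamma>) = infsum h (F \<gamma>) * k \<gamma>"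
    for h :: "'t \<Rightarrow> real" and k \<gamma>
    unfolding infsum_cmult_left'[symmetric] by (rule infsum_cong) (simp add: F_def)
  have fib_abs: "(\<lambda>t. \<bar>b t\<bar>) summable_on F \<gamma>" for \<gamma>
  proof -
    have "(\<lambda>t. \<bar>b t\<bar> * r ^ total_degree (e t)) summable_on F \<gamma>"
      by (rule summable_on_subset_banach[OF has_sum_imp_summable[OF abs]]) (auto simp: F_def)
    then have "(\<lambda>t. \<bar>b t\<bar> * r ^ total_degree \<gamma>) summable_on F \<gamma>"
      by (rule summable_on_cong[THEN iffD1, rotated]) (simp add: F_def)
    then show ?thesis
      using r by (subst (asm) summable_on_cmult_left') auto
  qed
  have "has_expansion c a r M g"
    unfolding has_expansion_def
  proof (intro conjI ballI r)
    fix x assume "x \<in> cube a r"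
    from has_sum_regroup[OF g[OF this], where e=e]
    show "((\<lambda>\<gamma>. c \<gamma> * multi_power (x - a) \<gamma>) has_sum g x) UNIV"
      by (simp only: F_def[symmetric] pull_out c_def)
  next
    from has_sum_regroup[OF abs, where e=e]
    have *: "((\<lambda>\<gamma>. infsum (\<lambda>t. \<bar>b t\<bar>) (F \<gamma>) * r ^ total_degree \<gamma>) has_sum S) UNIV"
      by (simp only: F_def[symmetric] pull_out[where k="\<lambda>\<gamma>. r ^ total_degree \<gamma>"])
    have le: "\<bar>\<bar>c \<gamma>\<bar> * r ^ total_degree \<gamma>\<bar> \<le> infsum (\<lambda>t. \<bar>b t\<bar>) (F \<gamma>) * r ^ total_degree \<gamma>" for \<gamma>
      using norm_infsum_bound[of b "F \<gamma>"] fib_abs r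
      by (auto simp: abs_mult c_def intro: mult_right_mono)
    have "(\<lambda>\<gamma>. \<bar>c \<gamma>\<bar> * r ^ total_degree \<gamma>) summable_on UNIV"
         "\<bar>infsum (\<lambda>\<gamma>. \<bar>c \<gamma>\<bar> * r ^ total_degree \<gamma>) UNIV\<bar> \<le> S"
      by (rule summable_abs_bound[OF *], rule le)+
    then show "\<exists>S\<le>M. ((\<lambda>\<alpha>. \<bar>c \<alpha>\<bar> * r ^ total_degree \<alpha>) has_sum S) UNIV"
      using S has_sum_infsum by (intro exI[of _ "infsum (\<lambda>\<gamma>. \<bar>c \<gamma>\<bar> * r ^ total_degree \<gamma>) UNIV"]) auto
  qed
  then show ?thesis by (auto simp: majorized_def)
qed

lemma majorized_pos: "majorized a r M g \<Longrightarrow> 0 < r"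
  by (auto simp: majorized_def has_expansion_def)

lemma majorized_cong:
  assumes "majorized a r M g" "\<And>x. x \<in> cube a r \<Longrightarrow> g x = h x"
  shows "majorized a r M h"
  using assms by (auto simp: majorized_def has_expansion_def)

lemma majorized_mono: "majorized a r M g \<Longrightarrow> M \<le> N \<Longrightarrow> majorized a r N g"
  by (auto simp: majorized_def has_expansion_def intro: order_trans)

lemma majorized_abs_le:
  assumes "majorized a r M g" "x \<in> cube a r"
  shows "\<bar>g x\<bar> \<le> M"
proof -
  obtain c S where "S \<le> M" and S: "((\<lambda>\<alpha>. \<bar>c \<alpha>\<bar> * r ^ total_degree \<alpha>) has_sum S) UNIV"
    and g: "((\<lambda>\<alpha>. c \<alpha> * multi_power (x - a) \<alpha>) has_sum g x) UNIV"
    using assms by (auto simp: majorized_def has_expansion_def)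
  have "\<bar>infsum (\<lambda>\<alpha>. c \<alpha> * multi_power (x - a) \<alpha>) UNIV\<bar> \<le> S"
    by (rule summable_abs_bound[OF S]) (rule abs_term_le[OF assms(2)])
  then show ?thesis using g \<open>S \<le> M\<close> infsumI by fastforce
qed

lemma majorized_nonneg: "majorized a r M g \<Longrightarrow> 0 \<le> M"
  using majorized_abs_le[of a r M g a] centre_in_cube[of r a] majorized_pos[of a r M g] by fastforce

text \<open>
  Completeness of the norm: a series of functions whose bounds are summable may be expanded termwise,
  by regarding it as one family of monomials indexed by pairs.
\<close>

lemma majorized_infsum:
  fixes g :: "'k \<Rightarrow> real ^ 'n \<Rightarrow> real"
  assumes r: "0 < r" and g: "\<And>k. k \<in> K \<Longrightarrow> majorized a r (M k) (g k)"
    and M: "(M has_sum T) K"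
  shows "majorized a r T (\<lambda>x. infsum (\<lambda>k. g k x) K)"
    and "\<And>x. x \<in> cube a r \<Longrightarrow> (\<lambda>k. g k x) summable_on K"
proof -
  obtain c where c: "\<And>k. k \<in> K \<Longrightarrow> has_expansion (c k) a r (M k) (g k)"
    using g unfolding majorized_def by metis
  then obtain S where S: "\<And>k. k \<in> K \<Longrightarrow> S k \<le> M k"
      "\<And>k. k \<in> K \<Longrightarrow> ((\<lambda>\<alpha>. \<bar>c k \<alpha>\<bar> * r ^ total_degree \<alpha>) has_sum S k) UNIV"
    unfolding has_expansion_def by metis
  have S0: "0 \<le> S k" if "k \<in> K" for k
    using has_sum_nonneg[OF S(2)[OF that]] r by auto
  have Ssum: "S summable_on K" and "\<bar>infsum S K\<bar> \<le> T"
    using summable_abs_bound[OF M, of S] S S0 by auto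
  define h where "h = (\<lambda>(k, \<alpha>). \<bar>c k \<alpha>\<bar> * r ^ total_degree \<alpha>)"
  have hs: "(h has_sum infsum S K) (Sigma K (\<lambda>_. UNIV))"
  proof (rule has_sum_SigmaI[where g=S])
    show "h summable_on (Sigma K (\<lambda>_. UNIV))"
      by (rule summable_on_SigmaI[where g=S]) (use S Ssum r in \<open>auto simp: h_def\<close>)
  qed (use S Ssum in \<open>auto simp: h_def\<close>)
  have x: "((\<lambda>t. c (fst t) (snd t) * multi_power (x - a) (snd t)) has_sum infsum (\<lambda>k. g k x) K) (Sigma K (\<lambda>_. UNIV)) \<and>
      (\<lambda>k. g k x) summable_on K" if xc: "x \<in> cube a r" for x
  proof -
    let ?f = "\<lambda>t. c (fst t) (snd t) * multi_power (x - a) (snd t)"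
    have "?f summable_on (Sigma K (\<lambda>_. UNIV))"
      by (rule summable_abs_bound[OF hs]) (use abs_term_le[OF xc] in \<open>auto simp: h_def\<close>)
    then have f: "(?f has_sum infsum ?f (Sigma K (\<lambda>_. UNIV))) (Sigma K (\<lambda>_. UNIV))" by simp
    then have "((\<lambda>k. g k x) has_sum infsum ?f (Sigma K (\<lambda>_. UNIV))) K"
      by (rule has_sum_SigmaD) (use c xc in \<open>auto simp: has_expansion_def\<close>)
    with f show ?thesis by (simp add: has_sum_iff)
  qed
  then show "\<And>x. x \<in> cube a r \<Longrightarrow> (\<lambda>k. g k x) summable_on K" by blast
  show "majorized a r T (\<lambda>x. infsum (\<lambda>k. g k x) K)"
  proof (rule majorized_of_monomial_family[where b="\<lambda>t. c (fst t) (snd t)" and e=snd and I="Sigma K (\<lambda>_. UNIV)"])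
    show "((\<lambda>t. \<bar>c (fst t) (snd t)\<bar> * r ^ total_degree (snd t)) has_sum infsum S K) (Sigma K (\<lambda>_. UNIV))"
      using hs by (simp add: h_def case_prod_beta')
  qed (use r x \<open>\<bar>infsum S K\<bar> \<le> T\<close> in auto)
qed

lemma majorized_sum:
  assumes "0 < r" "finite K" "\<And>k. k \<in> K \<Longrightarrow> majorized a r (M k) (g k)"
  shows "majorized a r (\<Sum>k\<in>K. M k) (\<lambda>x. \<Sum>k\<in>K. g k x)"
  using majorized_infsum(1)[of r K a M g "sum M K"] assms by simp

lemma majorized_mult:
  assumes "majorized a r M g" "majorized a r N h"
  shows "majorized a r (M * N) (\<lambda>x. g x * h x)"
proof -
  from assms obtain c S d T where r: "0 < r" and le: "S \<le> M" "T \<le> N"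
    and S: "((\<lambda>\<alpha>. \<bar>c \<alpha>\<bar> * r ^ total_degree \<alpha>) has_sum S) UNIV"
    and T: "((\<lambda>\<alpha>. \<bar>d \<alpha>\<bar> * r ^ total_degree \<alpha>) has_sum T) UNIV"
    and g: "\<And>x. x \<in> cube a r \<Longrightarrow> ((\<lambda>\<alpha>. c \<alpha> * multi_power (x - a) \<alpha>) has_sum g x) UNIV"
    and h: "\<And>x. x \<in> cube a r \<Longrightarrow> ((\<lambda>\<alpha>. d \<alpha> * multi_power (x - a) \<alpha>) has_sum h x) UNIV"
    by (auto simp: majorized_def has_expansion_def)
  have prod: "((\<lambda>t. p (fst t) * q (snd t)) has_sum P * Q) (Sigma UNIV (\<lambda>_. UNIV))"
    if "(p has_sum P) UNIV" "(q has_sum Q) UNIV"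
      "(\<lambda>t. p (fst t) * q (snd t)) summable_on (Sigma UNIV (\<lambda>_. UNIV))"
    for p q :: "('a \<Rightarrow> nat) \<Rightarrow> real" and P Q
    by (rule has_sum_SigmaI[where g="\<lambda>\<alpha>. p \<alpha> * Q"])
       (use that in \<open>auto intro!: has_sum_cmult_left has_sum_cmult_right\<close>)
  let ?p = "\<lambda>\<alpha>. \<bar>c \<alpha>\<bar> * r ^ total_degree \<alpha>" and ?q = "\<lambda>\<alpha>. \<bar>d \<alpha>\<bar> * r ^ total_degree \<alpha>"
  have "(\<lambda>t. ?p (fst t) * ?q (snd t)) summable_on (Sigma UNIV (\<lambda>_. UNIV))"
  proof (rule summable_on_SigmaI[where g="\<lambda>\<alpha>. ?p \<alpha> * T"])
    show "((\<lambda>y. ?p (fst (x, y)) * ?q (snd (x, y))) has_sum ?p x * T) UNIV" for x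
      using has_sum_cmult_right[OF T, of "?p x"] by simp
    show "(\<lambda>\<alpha>. ?p \<alpha> * T) summable_on UNIV"
      using has_sum_cmult_left[OF S] has_sum_imp_summable by blast
  qed (use r in auto)
  note pq = prod[OF S T this]
  show ?thesis
  proof (rule majorized_of_monomial_family[where b="\<lambda>t. c (fst t) * d (snd t)"
        and e="\<lambda>t i. fst t i + snd t i" and I="Sigma UNIV (\<lambda>_. UNIV)"])
    show "((\<lambda>t. \<bar>c (fst t) * d (snd t)\<bar> * r ^ total_degree (\<lambda>i. fst t i + snd t i)) has_sum S * T) (Sigma UNIV (\<lambda>_. UNIV))"
      using pq by (simp add: abs_mult total_degree_add power_add algebra_simps)
    show "S * T \<le> M * N"
      using le has_sum_nonneg[OF S] has_sum_nonneg[OF T] r by (intro mult_mono) auto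
    fix x assume x: "x \<in> cube a r"
    have "(\<lambda>t. (c (fst t) * multi_power (x - a) (fst t)) * (d (snd t) * multi_power (x - a) (snd t)))
        summable_on (Sigma UNIV (\<lambda>_. UNIV))"
    proof (rule summable_abs_bound[OF pq])
      show "\<bar>(c (fst t) * multi_power (x - a) (fst t)) * (d (snd t) * multi_power (x - a) (snd t))\<bar> \<le> ?p (fst t) * ?q (snd t)" for t
        unfolding abs_mult[of "c (fst t) * multi_power (x - a) (fst t)"] using abs_term_le[OF x] r by (intro mult_mono) auto
    qed
    from prod[OF g[OF x] h[OF x] this]
    show "((\<lambda>t. c (fst t) * d (snd t) * multi_power (x - a) (\<lambda>i. fst t i + snd t i)) has_sum g x * h x) (Sigma UNIV (\<lambda>_. UNIV))"
      by (simp add: multi_power_add algebra_simps)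
  qed (fact r)
qed

lemma majorized_const:
  assumes "0 < r"
  shows "majorized a r \<bar>k\<bar> (\<lambda>_. k)"
proof (rule majorized_of_monomial_family[where I="{()}" and b="\<lambda>_. k" and e="\<lambda>_ _. 0" and S="\<bar>k\<bar>"])
qed (use assms in \<open>auto simp: multi_power_def total_degree_def has_sum_finite_iff\<close>)

definition unit_index :: "'n \<Rightarrow> 'n \<Rightarrow> nat" where
  "unit_index j = (\<lambda>i. if i = j then 1 else 0)"

lemma multi_power_unit_index [simp]: "multi_power y (unit_index j) = y $ j"
  by (simp add: multi_power_def unit_index_def if_distrib[where f="\<lambda>n. _ ^ n"] cong: if_cong)

lemma total_degree_unit_index [simp]: "total_degree (unit_index j) = 1"
  by (simp add: total_degree_def unit_index_def)

lemma majorized_coordinate: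
  assumes "0 < r"
  shows "majorized a r r (\<lambda>x. x $ j - a $ j)"
proof (rule majorized_of_monomial_family[where I="{()}" and b="\<lambda>_. 1" and e="\<lambda>_. unit_index j" and S=r])
qed (use assms in \<open>auto simp: has_sum_finite_iff\<close>)

lemma majorized_power:
  assumes "majorized a r M g"
  shows "majorized a r (M ^ n) (\<lambda>x. g x ^ n)"
proof (induction n)
  case 0
  show ?case using majorized_const[OF majorized_pos[OF assms], of a 1] by simp
next
  case (Suc n)
  show ?case using majorized_mult[OF assms Suc] by simp
qed

lemma majorized_prod:
  assumes "0 < r" "finite K" "\<And>k. k \<in> K \<Longrightarrow> majorized a r (M k) (g k)"
  shows "majorized a r (\<Prod>k\<in>K. M k) (\<lambda>x. \<Prod>k\<in>K. g k x)"
  using assms(2,3)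
proof (induction K rule: finite_induct)
  case empty
  show ?case using majorized_const[OF assms(1), of a 1] by simp
next
  case (insert k K)
  then show ?case using majorized_mult[of a r "M k" "g k"] by simp
qed

lemma majorized_add:
  assumes "majorized a r M g" "majorized a r N h"
  shows "majorized a r (M + N) (\<lambda>x. g x + h x)"
  using majorized_sum[of r "UNIV :: bool set" a "\<lambda>b. if b then M else N" "\<lambda>b. if b then g else h"]
    assms majorized_pos[OF assms(1)] by (simp add: UNIV_bool add.commute)

lemma majorized_cmult:
  assumes "majorized a r M g"
  shows "majorized a r (\<bar>k\<bar> * M) (\<lambda>x. k * g x)"
  using majorized_mult[OF majorized_const assms] majorized_pos[OF assms] by blast

text \<open>
  Substituting the series of \<open>h - b\<close> into that of \<open>g\<close> replaces each monomial by a product whose norm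
  is at most \<open>\<rho>\<close> to the degree, so that the norms of the terms sum up to at most \<open>M\<close>.
\<close>

lemma majorized_compose:
  assumes g: "majorized b \<rho> M g" and h: "\<And>i. majorized a r \<rho> (\<lambda>x. h x $ i - b $ i)"
  shows "majorized a r M (\<lambda>x. g (h x))"
proof -
  obtain c S where \<rho>: "0 < \<rho>" and "S \<le> M"
    and S: "((\<lambda>\<alpha>. \<bar>c \<alpha>\<bar> * \<rho> ^ total_degree \<alpha>) has_sum S) UNIV"
    and gs: "\<And>x. x \<in> cube b \<rho> \<Longrightarrow> ((\<lambda>\<alpha>. c \<alpha> * multi_power (x - b) \<alpha>) has_sum g x) UNIV"
    using g by (auto simp: majorized_def has_expansion_def)
  have r: "0 < r" using h majorized_pos by blast
  have "majorized a r S (\<lambda>x. infsum (\<lambda>\<alpha>. c \<alpha> * multi_power (h x - b) \<alpha>) UNIV)"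
  proof (rule majorized_infsum(1)[OF r _ S])
    fix \<alpha> :: "'a \<Rightarrow> nat"
    have "majorized a r (\<Prod>i\<in>UNIV. \<rho> ^ \<alpha> i) (\<lambda>x. multi_power (h x - b) \<alpha>)"
      unfolding multi_power_def using h by (intro majorized_prod r majorized_power) auto
    then show "majorized a r (\<bar>c \<alpha>\<bar> * \<rho> ^ total_degree \<alpha>) (\<lambda>x. c \<alpha> * multi_power (h x - b) \<alpha>)"
      by (intro majorized_cmult) (simp add: total_degree_def power_sum)
  qed
  then have "majorized a r S (\<lambda>x. g (h x))"
  proof (rule majorized_cong)
    fix x assume "x \<in> cube a r"
    then have "h x \<in> cube b \<rho>" using majorized_abs_le[OF h] by (intro cubeI) blast
    then show "infsum (\<lambda>\<alpha>. c \<alpha> * multi_power (h x - b) \<alpha>) UNIV = g (h x)"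
      using gs infsumI by blast
  qed
  then show ?thesis using \<open>S \<le> M\<close> majorized_mono by blast
qed

text \<open>
  Composition with the identity map, whose coordinates relative to \<open>a\<close> are affine functions
  centred at \<open>b\<close> of norm \<open>s + \<bar>b\<^sub>i - a\<^sub>i\<bar> \<le> r\<close>.
\<close>

lemma majorized_recenter:
  assumes "majorized a r M g" "0 < s" "b \<in> cube a (r - s)"
  shows "majorized b s M g"
proof (rule majorized_compose[OF assms(1), where h="\<lambda>x. x"])
  fix i
  have "majorized b s (s + \<bar>b $ i - a $ i\<bar>) (\<lambda>x. (x $ i - b $ i) + (b $ i - a $ i))"
    using assms by (intro majorized_add majorized_coordinate majorized_const)
  then show "majorized b s r (\<lambda>x. x $ i - a $ i)"
    using cubeD[OF assms(3), of i] majorized_mono by fastforce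
qed

lemma majorized_shrink:
  assumes "majorized a r M g" "0 < s" "s \<le> r"
  shows "majorized a s M g"
  using assms centre_in_cube[of "r - s" a] by (intro majorized_recenter[OF assms(1)]) auto

lemma has_expansion_at_centre:
  assumes "has_expansion c a r M g"
  shows "c (\<lambda>_. 0) = g a"
proof -
  have z: "multi_power 0 \<alpha> = 0" if "\<alpha> \<noteq> (\<lambda>_. 0)" for \<alpha> :: "'a \<Rightarrow> nat"
    using that by (auto simp: multi_power_def fun_eq_iff)
  have "((\<lambda>\<alpha>. c \<alpha> * multi_power 0 \<alpha>) has_sum g a) UNIV"
    using assms centre_in_cube[of r a] by (auto simp: has_expansion_def)
  moreover have "((\<lambda>\<alpha>. c \<alpha> * multi_power 0 \<alpha>) has_sum c (\<lambda>_. 0)) UNIV"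
    by (rule has_sum_finite_neutralI[where B="{\<lambda>_. 0}"]) (auto simp: z, auto simp: multi_power_def)
  ultimately show ?thesis using has_sum_unique by blast
qed

text \<open>
  Each remaining coefficient has degree at least \<open>p\<close>, so its weight drops at least by the factor
  \<open>(s / r)\<^sup>p\<close> when the radius drops from \<open>r\<close> to \<open>s\<close>.
\<close>

lemma has_expansion_schwarz:
  assumes e: "has_expansion c a r M g" and s: "0 < s" "s \<le> r"
    and c0: "\<And>\<alpha>. total_degree \<alpha> < p \<Longrightarrow> c \<alpha> = 0"
  shows "has_expansion c a s ((s / r) ^ p * M) g"
proof -
  obtain S where r: "0 < r" and "S \<le> M" and S: "((\<lambda>\<alpha>. \<bar>c \<alpha>\<bar> * r ^ total_degree \<alpha>) has_sum S) UNIV"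
    using e by (auto simp: has_expansion_def)
  have le: "\<bar>\<bar>c \<alpha>\<bar> * s ^ total_degree \<alpha>\<bar> \<le> (s / r) ^ p * (\<bar>c \<alpha>\<bar> * r ^ total_degree \<alpha>)" for \<alpha>
  proof (cases "total_degree \<alpha> < p")
    case False
    have "(s / r) ^ total_degree \<alpha> \<le> (s / r) ^ p"
      using False r s by (intro power_decreasing) auto
    then have "s ^ total_degree \<alpha> \<le> (s / r) ^ p * r ^ total_degree \<alpha>"
      using r by (simp add: power_divide divide_simps mult.commute split: if_splits)
    then show ?thesis
      using s mult_left_mono[of "s ^ total_degree \<alpha>" "(s / r) ^ p * r ^ total_degree \<alpha>" "\<bar>c \<alpha>\<bar>"]
      by (simp add: abs_mult algebra_simps)
  qed (simp add: c0)
  note hs = has_sum_cmult_right[OF S, of "(s / r) ^ p"]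
  have "(\<lambda>\<alpha>. \<bar>c \<alpha>\<bar> * s ^ total_degree \<alpha>) summable_on UNIV"
       "\<bar>infsum (\<lambda>\<alpha>. \<bar>c \<alpha>\<bar> * s ^ total_degree \<alpha>) UNIV\<bar> \<le> (s / r) ^ p * S"
    by (rule summable_abs_bound[OF hs], rule le)+
  moreover have "(s / r) ^ p * S \<le> (s / r) ^ p * M"
    using \<open>S \<le> M\<close> r s by (intro mult_left_mono) auto
  ultimately have "\<exists>S\<le>(s / r) ^ p * M. ((\<lambda>\<alpha>. \<bar>c \<alpha>\<bar> * s ^ total_degree \<alpha>) has_sum S) UNIV"
    by (intro exI[of _ "infsum (\<lambda>\<alpha>. \<bar>c \<alpha>\<bar> * s ^ total_degree \<alpha>) UNIV"]) auto
  then show ?thesis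
    using e s cube_mono[OF s(2), of a] by (auto simp: has_expansion_def)
qed

lemma total_degree_0_iff: "total_degree \<alpha> = 0 \<longleftrightarrow> \<alpha> = (\<lambda>_. 0)"
  by (auto simp: total_degree_def)

lemma majorized_schwarz:
  assumes "majorized a r M g" "g a = 0" "0 < s" "s \<le> r"
  shows "majorized a s (s / r * M) g"
proof -
  obtain c where c: "has_expansion c a r M g" using assms by (auto simp: majorized_def)
  have "c \<alpha> = 0" if "total_degree \<alpha> < 1" for \<alpha>
    using that has_expansion_at_centre[OF c] assms by (simp add: total_degree_0_iff)
  from has_expansion_schwarz[OF c assms(3,4), where p=1] this show ?thesis by (auto simp: majorized_def)
qed

lemma total_degree_1: "total_degree \<alpha> = 1 \<longleftrightarrow> (\<exists>j. \<alpha> = unit_index j)"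
proof
  assume "total_degree \<alpha> = 1"
  then obtain j where "\<alpha> j = 1" "\<And>i. i \<noteq> j \<Longrightarrow> \<alpha> i = 0"
    unfolding total_degree_def by (subst (asm) sum_eq_1_iff) auto
  then show "\<exists>j. \<alpha> = unit_index j" by (intro exI[of _ j]) (auto simp: unit_index_def)
qed auto

lemma inj_unit_index: "inj unit_index"
  by (auto simp: inj_def unit_index_def fun_eq_iff split: if_splits)

text \<open>
  Deleting the coefficients of degree zero and one leaves a series to which the previous estimate
  applies with \<open>p = 2\<close>. The numbers \<open>l j\<close> are the linear coefficients.
\<close>

lemma majorized_linear_part:
  assumes "majorized a r M g"
  obtains l where "\<And>s. 0 < s \<Longrightarrow> s \<le> r \<Longrightarrow>
    majorized a s ((s / r)\<^sup>2 * M) (\<lambda>x. g x - g a - (\<Sum>j\<in>UNIV. l j * (x $ j - a $ j)))"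
proof -
  obtain c where c: "has_expansion c a r M g" using assms by (auto simp: majorized_def)
  define L :: "('a \<Rightarrow> nat) set" where "L = insert (\<lambda>_. 0) (range unit_index)"
  have L: "L = {\<alpha>. total_degree \<alpha> < 2}"
    using total_degree_0_iff total_degree_1 by (auto simp: L_def less_2_cases_iff)
  define l where "l j = c (unit_index j)" for j
  define d where "d \<alpha> = (if \<alpha> \<in> L then 0 else c \<alpha>)" for \<alpha>
  have notin: "(\<lambda>_. 0) \<notin> range (unit_index :: 'a \<Rightarrow> _)"
    using total_degree_unit_index total_degree_0_iff by (metis imageE zero_neq_one)
  have "has_expansion d a r M (\<lambda>x. g x - g a - (\<Sum>j\<in>UNIV. l j * (x $ j - a $ j)))"
    unfolding has_expansion_def
  proof (intro conjI ballI)
    show r: "0 < r" using c by (simp add: has_expansion_def)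
    obtain S where "S \<le> M" and S: "((\<lambda>\<alpha>. \<bar>c \<alpha>\<bar> * r ^ total_degree \<alpha>) has_sum S) UNIV"
      using c by (auto simp: has_expansion_def)
    have "(\<lambda>\<alpha>. \<bar>d \<alpha>\<bar> * r ^ total_degree \<alpha>) summable_on UNIV"
         "\<bar>infsum (\<lambda>\<alpha>. \<bar>d \<alpha>\<bar> * r ^ total_degree \<alpha>) UNIV\<bar> \<le> S"
      by (rule summable_abs_bound[OF S], use r in \<open>auto simp: d_def abs_mult\<close>)+
    then show "\<exists>S\<le>M. ((\<lambda>\<alpha>. \<bar>d \<alpha>\<bar> * r ^ total_degree \<alpha>) has_sum S) UNIV"
      using \<open>S \<le> M\<close> by (intro exI[of _ "infsum (\<lambda>\<alpha>. \<bar>d \<alpha>\<bar> * r ^ total_degree \<alpha>) UNIV"]) auto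
    fix x assume "x \<in> cube a r"
    then have 1: "((\<lambda>\<alpha>. c \<alpha> * multi_power (x - a) \<alpha>) has_sum g x) UNIV"
      using c by (auto simp: has_expansion_def)
    let ?f = "\<lambda>\<alpha>. if \<alpha> \<in> L then - c \<alpha> * multi_power (x - a) \<alpha> else 0"
    have "(?f has_sum (\<Sum>\<alpha>\<in>L. ?f \<alpha>)) UNIV"
      by (rule has_sum_finite_neutralI[where B=L]) (auto simp: L_def)
    moreover have "(\<Sum>\<alpha>\<in>L. ?f \<alpha>) = - g a - (\<Sum>j\<in>UNIV. l j * (x $ j - a $ j))"
    proof -
      have "(\<Sum>\<alpha>\<in>L. ?f \<alpha>) = (\<Sum>\<alpha>\<in>L. - (c \<alpha> * multi_power (x - a) \<alpha>))"
        by (rule sum.cong) auto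
      also have "\<dots> = - (c (\<lambda>_. 0) * multi_power (x - a) (\<lambda>_. 0)) + (\<Sum>\<alpha>\<in>range unit_index. - (c \<alpha> * multi_power (x - a) \<alpha>))"
        unfolding L_def using notin by (subst sum.insert) auto
      also have "(\<Sum>\<alpha>\<in>range unit_index. - (c \<alpha> * multi_power (x - a) \<alpha>)) = - (\<Sum>j\<in>UNIV. l j * (x $ j - a $ j))"
        using inj_unit_index by (subst sum.reindex) (auto simp: o_def l_def sum_negf)
      also have "c (\<lambda>_. 0) * multi_power (x - a) (\<lambda>_. 0) = g a"
        using has_expansion_at_centre[OF c] by (simp add: multi_power_def)
      finally show ?thesis by simp
    qed
    ultimately have "(?f has_sum (- g a - (\<Sum>j\<in>UNIV. l j * (x $ j - a $ j)))) UNIV" by simp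
    from has_sum_add[OF 1 this]
    have "((\<lambda>\<alpha>. c \<alpha> * multi_power (x - a) \<alpha> + ?f \<alpha>) has_sum (g x - g a - (\<Sum>j\<in>UNIV. l j * (x $ j - a $ j)))) UNIV"
      by (simp only: add_diff_eq diff_conv_add_uminus add.assoc)
    then show "((\<lambda>\<alpha>. d \<alpha> * multi_power (x - a) \<alpha>) has_sum (g x - g a - (\<Sum>j\<in>UNIV. l j * (x $ j - a $ j)))) UNIV"
      by (rule has_sum_cong[THEN iffD1, rotated]) (auto simp: d_def)
  qed
  from has_expansion_schwarz[OF this, where p=2] show ?thesis
    by (intro that[of l]) (auto simp: majorized_def d_def L)
qed

text \<open>
  The quadratic bound of the remainder identifies the linear coefficients with the derivative; both
  facts are needed together when the linear part of an iterate is computed by the chain rule.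
\<close>

lemma majorized_derivative:
  assumes "majorized a r M g"
  obtains l where "(g has_derivative (\<lambda>h. \<Sum>j\<in>UNIV. l j * h $ j)) (at a)"
    and "\<And>s. 0 < s \<Longrightarrow> s \<le> r \<Longrightarrow>
    majorized a s ((s / r)\<^sup>2 * M) (\<lambda>x. g x - g a - (\<Sum>j\<in>UNIV. l j * (x $ j - a $ j)))"
proof -
  obtain l where l: "\<And>s. 0 < s \<Longrightarrow> s \<le> r \<Longrightarrow>
    majorized a s ((s / r)\<^sup>2 * M) (\<lambda>x. g x - g a - (\<Sum>j\<in>UNIV. l j * (x $ j - a $ j)))"
    using majorized_linear_part[OF assms] by blast
  have r: "0 < r" and M: "0 \<le> M" using assms majorized_pos majorized_nonneg by auto
  have "(g has_derivative (\<lambda>h. \<Sum>j\<in>UNIV. l j * h $ j)) (at a)"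
    unfolding has_derivative_at_alt
  proof (intro conjI allI impI)
    show "bounded_linear (\<lambda>h. \<Sum>j\<in>UNIV. l j * h $ j)"
      by (intro bounded_linear_sum bounded_linear_const_mult bounded_linear_vec_nth)
    fix e :: real assume "0 < e"
    define d where "d = min r (e * r\<^sup>2 / (M + 1))"
    show "\<exists>d>0. \<forall>y. norm (y - a) < d \<longrightarrow>
        norm (g y - g a - (\<Sum>j\<in>UNIV. l j * (y - a) $ j)) \<le> e * norm (y - a)"
    proof (intro exI[of _ d] conjI allI impI)
      show "0 < d" using r M \<open>0 < e\<close> by (simp add: d_def)
      fix y assume y: "norm (y - a) < d"
      show "norm (g y - g a - (\<Sum>j\<in>UNIV. l j * (y - a) $ j)) \<le> e * norm (y - a)"
      proof (cases "y = a")
        case False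
        define s where "s = norm (y - a)"
        have s: "0 < s" "s \<le> r" "s \<le> e * r\<^sup>2 / (M + 1)"
          using y False by (auto simp: s_def d_def)
        have "y \<in> cube a s"
          using cball_subset_cube[of a s] by (auto simp: s_def dist_norm norm_minus_commute)
        from majorized_abs_le[OF l[OF s(1,2)] this]
        have "\<bar>g y - g a - (\<Sum>j\<in>UNIV. l j * (y $ j - a $ j))\<bar> \<le> (s / r)\<^sup>2 * M" .
        also have "\<dots> = s * (s * M / r\<^sup>2)" by (simp add: power2_eq_square)
        also have "\<dots> \<le> s * e"
        proof (rule mult_left_mono)
          have "s * M \<le> s * (M + 1)" using s by simp
          also have "\<dots> \<le> e * r\<^sup>2" using s M by (simp add: pos_le_divide_eq)
          finally show "s * M / r\<^sup>2 \<le> e" using r by (simp add: pos_divide_le_eq)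
        qed (use s in simp)
        finally show ?thesis by (simp add: s_def mult.commute)
      qed simp
    qed
  qed
  then show ?thesis using l that by blast
qed

lemma majorized_isCont: "majorized a r M g \<Longrightarrow> isCont g a"
  by (metis majorized_derivative has_derivative_continuous)

section \<open>Real analytic functions of several variables\<close>

text \<open>
  Unconditional convergence at a single point with all coordinates off the centre by \<open>s\<close> already
  gives a finite norm for the radius \<open>s\<close>, since real series converge unconditionally only if they converge
  absolutely. The factor \<open>1 / n\<close> in \<open>s\<close> puts the cube inside the Euclidean ball.
\<close>

lemma real_analytic_at_iff_majorized:
  fixes g :: "real ^ 'n \<Rightarrow> real"
  shows "real_analytic_at g a \<longleftrightarrow> (\<exists>r M. majorized a r M g)"
proof
  assume "real_analytic_at g a"
  then obtain r c where r: "0 < r"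
    and c: "\<And>x. x \<in> ball a r \<Longrightarrow> ((\<lambda>\<alpha>. multi_power (x - a) \<alpha> * c \<alpha>) has_sum g x) UNIV"
    unfolding real_analytic_at_def multi_power_def real_scaleR_def vector_minus_component by blast
  define s where "s = r / (2 * real CARD('n))"
  have s: "0 < s" using r by (simp add: s_def)
  have sub: "cube a s \<subseteq> ball a r"
  proof
    fix x assume x: "x \<in> cube a s"
    have "norm (x - a) \<le> (\<Sum>i\<in>UNIV. \<bar>(x - a) $ i\<bar>)" by (rule norm_le_l1_cart)
    also have "\<dots> \<le> (\<Sum>i\<in>(UNIV :: 'n set). s)"
      using cubeD[OF x] by (intro sum_mono) simp
    also have "\<dots> = r / 2" by (simp add: s_def)
    finally show "x \<in> ball a r" using r by (simp add: dist_norm norm_minus_commute)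
  qed
  define z where "z = (\<chi> i. a $ i + s)"
  have "z \<in> cube a s" using s by (simp add: z_def cube_def)
  then have "((\<lambda>\<alpha>. multi_power (z - a) \<alpha> * c \<alpha>) has_sum g z) UNIV" using c sub by blast
  moreover have "multi_power (z - a) \<alpha> = s ^ total_degree \<alpha>" for \<alpha>
    by (simp add: multi_power_def z_def total_degree_def power_sum)
  ultimately have "(\<lambda>\<alpha>. s ^ total_degree \<alpha> * c \<alpha>) summable_on UNIV"
    using has_sum_imp_summable by auto
  then have "(\<lambda>\<alpha>. norm (s ^ total_degree \<alpha> * c \<alpha>)) summable_on UNIV"
    by (rule summable_on_iff_abs_summable_on_real[THEN iffD1])
  then have "(\<lambda>\<alpha>. \<bar>c \<alpha>\<bar> * s ^ total_degree \<alpha>) summable_on UNIV"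
    using s by (simp add: abs_mult mult.commute)
  then have "has_expansion c a s (infsum (\<lambda>\<alpha>. \<bar>c \<alpha>\<bar> * s ^ total_degree \<alpha>) UNIV) g"
    using s c sub unfolding has_expansion_def
    by (auto simp: mult.commute intro!: exI[of _ "infsum (\<lambda>\<alpha>. \<bar>c \<alpha>\<bar> * s ^ total_degree \<alpha>) UNIV"])
  then show "\<exists>r M. majorized a r M g" by (auto simp: majorized_def)
next
  assume "\<exists>r M. majorized a r M g"
  then obtain r M c where c: "has_expansion c a r M g" by (auto simp: majorized_def)
  have "ball a r \<subseteq> cube a r"
    using cball_subset_cube[of a r] ball_subset_cball[of a r] by blast
  then show "real_analytic_at g a"
    using c unfolding real_analytic_at_def has_expansion_def multi_power_def
    by (auto simp: mult.commute intro!: exI[of _ r] exI[of _ c])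
qed

lemma real_analytic_at_component:
  fixes f :: "real ^ 'n \<Rightarrow> real ^ 'm"
  assumes "real_analytic_at f a"
  shows "real_analytic_at (\<lambda>x. f x $ i) a"
proof -
  obtain r c where "0 < r" and c: "\<And>x. x \<in> ball a r \<Longrightarrow>
      ((\<lambda>\<alpha>. (\<Prod>i\<in>UNIV. (x $ i - a $ i) ^ \<alpha> i) *\<^sub>R c \<alpha>) has_sum f x) UNIV"
    using assms unfolding real_analytic_at_def by blast
  show ?thesis
    unfolding real_analytic_at_def
  proof (intro exI[of _ r] exI[of _ "\<lambda>\<alpha>. c \<alpha> $ i"] conjI ballI \<open>0 < r\<close>)
    fix x assume "x \<in> ball a r"
    from has_sum_bounded_linear[OF bounded_linear_vec_nth c[OF this], of i]
    show "((\<lambda>\<alpha>. (\<Prod>i\<in>UNIV. (x $ i - a $ i) ^ \<alpha> i) *\<^sub>R (c \<alpha> $ i)) has_sum f x $ i) UNIV"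
      by simp
  qed
qed

lemma real_analytic_at_cong_open:
  assumes "real_analytic_at g a" "open N" "a \<in> N" "\<And>x. x \<in> N \<Longrightarrow> g x = h x"
  shows "real_analytic_at h a"
proof -
  obtain r c where "0 < r" and c: "\<And>x. x \<in> ball a r \<Longrightarrow>
      ((\<lambda>\<alpha>. (\<Prod>i\<in>UNIV. (x $ i - a $ i) ^ \<alpha> i) *\<^sub>R c \<alpha>) has_sum g x) UNIV"
    using assms unfolding real_analytic_at_def by blast
  obtain e where e: "0 < e" "ball a e \<subseteq> N" using assms open_contains_ball by blast
  show ?thesis
    unfolding real_analytic_at_def
  proof (intro exI[of _ "min r e"] exI[of _ c] conjI ballI)
    show "0 < min r e" using \<open>0 < r\<close> e by simp
    fix x assume "x \<in> ball a (min r e)"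
    then have "x \<in> ball a r" "x \<in> N" using e by auto
    then show "((\<lambda>\<alpha>. (\<Prod>i\<in>UNIV. (x $ i - a $ i) ^ \<alpha> i) *\<^sub>R c \<alpha>) has_sum h x) UNIV"
      using c[of x] assms(4)[of x] by simp
  qed
qed

text \<open>
  The bound is linear in the radius, by the Schwarz estimate.
\<close>

lemma majorized_small:
  assumes "real_analytic_at g a" "g a = (0::real)"
  obtains r M where "0 < r" "0 < M" "\<And>s. 0 < s \<Longrightarrow> s \<le> r \<Longrightarrow> majorized a s (M * s) g"
proof -
  obtain r M where m: "majorized a r M g" using assms real_analytic_at_iff_majorized by blast
  have r: "0 < r" "0 \<le> M" using m majorized_pos majorized_nonneg by auto
  show ?thesis
  proof (rule that[of r "M / r + 1"])
    fix s assume s: "0 < s" "s \<le> r"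
    have "s / r * M \<le> (M / r + 1) * s" using s by (simp add: algebra_simps)
    then show "majorized a s ((M / r + 1) * s) g"
      using majorized_schwarz[OF m assms(2) s] majorized_mono by blast
  qed (use r in \<open>auto intro: add_nonneg_pos\<close>)
qed

lemma majorized_small_finite:
  fixes g :: "'k \<Rightarrow> real ^ 'n \<Rightarrow> real"
  assumes "finite K" "\<And>k. k \<in> K \<Longrightarrow> real_analytic_at (g k) a" "\<And>k. k \<in> K \<Longrightarrow> g k a = 0"
  obtains r M where "0 < r" "0 < M"
    "\<And>k s. k \<in> K \<Longrightarrow> 0 < s \<Longrightarrow> s \<le> r \<Longrightarrow> majorized a s (M * s) (g k)"
proof -
  have "\<exists>r M. 0 < r \<and> 0 < M \<and> (\<forall>k\<in>K. \<forall>s. 0 < s \<longrightarrow> s \<le> r \<longrightarrow> majorized a s (M * s) (g k))"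
    using assms
  proof (induction K rule: finite_induct)
    case empty
    show ?case by (auto intro: exI[of _ 1])
  next
    case (insert k K)
    obtain r M where 1: "0 < r" "0 < M" "\<forall>k\<in>K. \<forall>s. 0 < s \<longrightarrow> s \<le> r \<longrightarrow> majorized a s (M * s) (g k)"
      using insert by (metis insertI2)
    obtain r' M' where 2: "0 < r'" "0 < M'" "\<And>s. 0 < s \<Longrightarrow> s \<le> r' \<Longrightarrow> majorized a s (M' * s) (g k)"
      using majorized_small insert.prems by (metis insertI1)
    show ?case
    proof (rule exI[of _ "min r r'"], rule exI[of _ "max M M'"], intro conjI ballI allI impI)
      fix j s assume j: "j \<in> insert k K" and s: "0 < s" "s \<le> min r r'"
      have "M * s \<le> max M M' * s" "M' * s \<le> max M M' * s" using s by (auto intro: mult_right_mono)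
      then show "majorized a s (max M M' * s) (g j)"
        using j s 1(3) 2(3) majorized_mono by (metis insertE min.boundedE)
    qed (use 1 2 in auto)
  qed
  then show ?thesis using that by blast
qed

lemma real_analytic_at_const: "real_analytic_at (\<lambda>_. k :: real) a"
  unfolding real_analytic_at_iff_majorized using majorized_const[of 1 a k] by auto

lemma real_analytic_at_coordinate: "real_analytic_at (\<lambda>x. x $ i) a"
proof -
  have "majorized a 1 (1 + \<bar>a $ i\<bar>) (\<lambda>x. (x $ i - a $ i) + a $ i)"
    by (intro majorized_add majorized_coordinate majorized_const) auto
  then show ?thesis unfolding real_analytic_at_iff_majorized by auto
qed

lemma real_analytic_at_add:
  fixes g h :: "real ^ 'n \<Rightarrow> real"
  assumes "real_analytic_at g a" "real_analytic_at h a"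
  shows "real_analytic_at (\<lambda>x. g x + h x) a"
proof -
  obtain r M s N where "majorized a r M g" "majorized a s N h"
    using assms unfolding real_analytic_at_iff_majorized by blast
  moreover from this have "0 < min r s" using majorized_pos by (metis min_def)
  ultimately have "majorized a (min r s) (M + N) (\<lambda>x. g x + h x)"
    by (intro majorized_add majorized_shrink[of a r M g "min r s"] majorized_shrink[of a s N h "min r s"]) auto
  then show ?thesis unfolding real_analytic_at_iff_majorized by blast
qed

lemma real_analytic_at_sum:
  fixes g :: "'k \<Rightarrow> real ^ 'n \<Rightarrow> real"
  assumes "\<And>k. k \<in> K \<Longrightarrow> real_analytic_at (g k) a"
  shows "real_analytic_at (\<lambda>x. \<Sum>k\<in>K. g k x) a"
  using assms
  by (induction K rule: infinite_finite_induct) (auto simp: real_analytic_at_const real_analytic_at_add)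

lemma real_analytic_at_power:
  fixes g :: "real ^ 'n \<Rightarrow> real"
  assumes "real_analytic_at g a"
  shows "real_analytic_at (\<lambda>x. g x ^ n) a"
  using assms majorized_power unfolding real_analytic_at_iff_majorized by blast

lemma real_analytic_at_cmult:
  fixes g :: "real ^ 'n \<Rightarrow> real"
  assumes "real_analytic_at g a"
  shows "real_analytic_at (\<lambda>x. k * g x) a"
  using assms majorized_cmult unfolding real_analytic_at_iff_majorized by blast

lemma real_analytic_at_diff:
  fixes g h :: "real ^ 'n \<Rightarrow> real"
  assumes "real_analytic_at g a" "real_analytic_at h a"
  shows "real_analytic_at (\<lambda>x. g x - h x) a"
  using real_analytic_at_add[OF assms(1) real_analytic_at_cmult[OF assms(2), of "-1"]] by simp

lemma real_analytic_at_compose: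
  fixes g :: "real ^ 'm \<Rightarrow> real" and h :: "real ^ 'n \<Rightarrow> real ^ 'm"
  assumes g: "real_analytic_at g (h a)" and h: "\<And>i. real_analytic_at (\<lambda>x. h x $ i) a"
  shows "real_analytic_at (\<lambda>x. g (h x)) a"
proof -
  obtain \<rho> N where gm: "majorized (h a) \<rho> N g" using g real_analytic_at_iff_majorized by blast
  have \<rho>: "0 < \<rho>" using gm majorized_pos by blast
  obtain r M where r: "0 < r" "0 < M"
    and m: "\<And>i s. i \<in> (UNIV :: 'm set) \<Longrightarrow> 0 < s \<Longrightarrow> s \<le> r \<Longrightarrow> majorized a s (M * s) (\<lambda>x. h x $ i - h a $ i)"
    by (rule majorized_small_finite[of "UNIV :: 'm set" "\<lambda>i x. h x $ i - h a $ i" a])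
       (auto intro!: real_analytic_at_diff h real_analytic_at_const)
  define s where "s = min r (\<rho> / M)"
  have s: "0 < s" "s \<le> r" "M * s \<le> \<rho>"
    using r \<rho> by (auto simp: s_def min_def field_simps)
  have "majorized a s N (\<lambda>x. g (h x))"
    by (rule majorized_compose[OF gm]) (use m s majorized_mono in blast)
  then show ?thesis using real_analytic_at_iff_majorized by blast
qed

lemma real_analytic_at_isCont: "real_analytic_at g a \<Longrightarrow> isCont g a" for g :: "real ^ 'n \<Rightarrow> real"
  using real_analytic_at_iff_majorized majorized_isCont by blast

lemma real_analytic_at_differentiable:
  fixes f :: "real ^ 'n \<Rightarrow> real ^ 'm"
  assumes "real_analytic_at f a"
  shows "f differentiable (at a)"
  unfolding differentiable_componentwise_within[of f a UNIV]
proof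
  fix b :: "real ^ 'm" assume "b \<in> Basis"
  then obtain i where "b = axis i 1" by (auto simp: Basis_vec_def)
  moreover obtain r M where "majorized a r M (\<lambda>x. f x $ i)"
    using real_analytic_at_component[OF assms] real_analytic_at_iff_majorized by blast
  then have "(\<lambda>x. f x $ i) differentiable (at a)"
    by (metis majorized_derivative differentiable_def)
  ultimately show "(\<lambda>x. f x \<bullet> b) differentiable (at a)" by (simp add: inner_axis)
qed

subsection \<open>The identity theorem\<close>

text \<open>
  The coefficients vanish one after the other: after division by \<open>t\<^sup>d\<close>, the next one is the limit at
  \<open>0\<close> of the zero function.
\<close>

lemma power_series_zero_coefficients:
  fixes b :: "nat \<Rightarrow> real"
  assumes "0 < s" and z: "\<And>t. norm t < s \<Longrightarrow> (\<lambda>n. b n * t ^ n) sums 0"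
  shows "b d = 0"
proof (induction d rule: less_induct)
  case (less d)
  have "(\<lambda>n. b (n + d) * t ^ n) sums 0" if "t \<noteq> 0" "norm t < s" for t
  proof -
    have "(\<lambda>n. b (n + d) * t ^ (n + d)) sums 0"
      using sums_split_initial_segment[OF z[OF that(2)], of d] less by simp
    from sums_mult[OF this, of "1 / t ^ d"] show ?thesis
      using that(1) by (simp add: power_add)
  qed
  from powser_limit_0_strong[OF \<open>0 < s\<close> this] show ?case
    by (simp add: tendsto_const_iff)
qed

text \<open>
  Along the segment from \<open>a\<close> to \<open>y\<close>, grouping the series by total degree gives a power series in one
  variable that vanishes near \<open>0\<close>. Hence all its coefficients vanish, and so does its value at \<open>1\<close>.
\<close>

lemma majorized_eq_zero_of_locally_zero:
  assumes m: "majorized a r M g" and "0 < \<delta>" and z: "\<And>x. x \<in> ball a \<delta> \<Longrightarrow> g x = 0"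
    and y: "y \<in> cube a r"
  shows "g y = 0"
proof -
  obtain c where "has_expansion c a r M g" using m by (auto simp: majorized_def)
  then have c: "\<And>x. x \<in> cube a r \<Longrightarrow> ((\<lambda>\<alpha>. c \<alpha> * multi_power (x - a) \<alpha>) has_sum g x) UNIV"
    by (auto simp: has_expansion_def)
  define b where "b d = infsum (\<lambda>\<alpha>. c \<alpha> * multi_power (y - a) \<alpha>) {\<alpha>. total_degree \<alpha> = d}" for d
  have b: "(\<lambda>d. b d * t ^ d) sums g (a + t *\<^sub>R (y - a))" if "\<bar>t\<bar> \<le> 1" for t
  proof (rule has_sum_imp_sums)
    have "\<bar>(a + t *\<^sub>R (y - a)) $ i - a $ i\<bar> \<le> r" for i
      using mult_mono[OF that cubeD[OF y, of i]] by (simp add: abs_mult)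
    then have "a + t *\<^sub>R (y - a) \<in> cube a r" by (rule cubeI)
    from has_sum_regroup[OF c[OF this], where e=total_degree]
    have "((\<lambda>d. infsum (\<lambda>\<alpha>. c \<alpha> * multi_power (t *\<^sub>R (y - a)) \<alpha>) {\<alpha>. total_degree \<alpha> = d}) has_sum g (a + t *\<^sub>R (y - a))) UNIV"
      by simp
    moreover have "infsum (\<lambda>\<alpha>. c \<alpha> * multi_power (t *\<^sub>R (y - a)) \<alpha>) {\<alpha>. total_degree \<alpha> = d} = b d * t ^ d" for d
      unfolding b_def infsum_cmult_left'[symmetric] by (rule infsum_cong) (simp add: multi_power_scale)
    ultimately show "((\<lambda>d. b d * t ^ d) has_sum g (a + t *\<^sub>R (y - a))) UNIV" by simp
  qed
  define s where "s = min 1 (\<delta> / (norm (y - a) + 1))"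
  have "(\<lambda>d. b d * t ^ d) sums 0" if "norm t < s" for t
  proof -
    have "\<bar>t\<bar> \<le> 1" using that by (simp add: s_def)
    have "\<bar>t\<bar> * (norm (y - a) + 1) < \<delta>"
      using that by (simp add: s_def pos_less_divide_eq add_nonneg_pos)
    then have "\<bar>t\<bar> * norm (y - a) < \<delta>" by (simp add: algebra_simps)
    then have "a + t *\<^sub>R (y - a) \<in> ball a \<delta>" by (simp add: dist_norm)
    then show ?thesis using b[OF \<open>\<bar>t\<bar> \<le> 1\<close>] z by simp
  qed
  moreover have "0 < s" using \<open>0 < \<delta>\<close> by (simp add: s_def add_nonneg_pos)
  ultimately have "b d = 0" for d using power_series_zero_coefficients by blast
  then show ?thesis using b[of 1] sums_unique2[OF sums_zero] by fastforce
qed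

text \<open>
  The identity theorem. The interior \<open>Z\<close> of the zero set is also relatively closed: a point \<open>z \<in> Z\<close> with
  distance less than \<open>r / 4\<close> from a centre \<open>x\<close> of expansion with radius \<open>r\<close> is itself a centre of
  expansion with radius \<open>r / 2\<close>, and the corresponding cube contains a neighbourhood of \<open>x\<close>.
\<close>

lemma real_analytic_on_eq_zero:
  fixes g :: "real ^ 'n \<Rightarrow> real"
  assumes C: "open C" "connected C" and g: "real_analytic_on g C"
    and N: "open N" "N \<noteq> {}" "N \<subseteq> C" "\<And>x. x \<in> N \<Longrightarrow> g x = 0" and x: "x \<in> C"
  shows "g x = 0"
proof -
  define Z where "Z = interior {x \<in> C. g x = 0}"
  have "N \<subseteq> Z" unfolding Z_def using N by (intro interior_maximal) auto
  have Z: "Z \<subseteq> C" "\<And>x. x \<in> Z \<Longrightarrow> g x = 0" "open Z"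
    using interior_subset[of "{x \<in> C. g x = 0}"] by (auto simp: Z_def)
  have "open (C - Z)"
    unfolding open_subopen[of "C - Z"]
  proof
    fix x assume x: "x \<in> C - Z"
    then obtain r M where m: "majorized x r M g"
      using g unfolding real_analytic_on_def real_analytic_at_iff_majorized by blast
    have r: "0 < r" using m majorized_pos by blast
    have "ball x (r / 4) \<inter> Z = {}"
    proof (rule ccontr)
      assume "ball x (r / 4) \<inter> Z \<noteq> {}"
      then obtain z where z: "z \<in> ball x (r / 4)" "z \<in> Z" by blast
      have "z \<in> cube x (r - r / 2)"
        using cball_subset_cube[of x "r - r / 2"] z r by auto
      then have mz: "majorized z (r / 2) M g" using r by (intro majorized_recenter[OF m]) auto
      obtain \<delta> where "0 < \<delta>" "ball z \<delta> \<subseteq> Z" using z Z open_contains_ball by blast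
      then have "g y = 0" if "y \<in> cube z (r / 2)" for y
        using majorized_eq_zero_of_locally_zero[OF mz] Z that by blast
      moreover have "ball x (r / 4) \<subseteq> cube z (r / 2)"
      proof
        fix y assume "y \<in> ball x (r / 4)"
        then have "dist z y \<le> r / 2" using z dist_triangle[of z y x] by (simp add: dist_commute)
        then show "y \<in> cube z (r / 2)" using cball_subset_cube[of z "r / 2"] by auto
      qed
      ultimately have "ball x (r / 4) \<inter> C \<subseteq> Z"
        unfolding Z_def using C by (intro interior_maximal) auto
      moreover have "x \<in> ball x (r / 4)" using r by simp
      ultimately show False using x by blast
    qed
    then show "\<exists>T. open T \<and> x \<in> T \<and> T \<subseteq> C - Z"
      using C x r by (intro exI[of _ "ball x (r / 4) \<inter> C"]) auto
  qed
  moreover have "Z \<inter> C \<noteq> {}" using \<open>N \<subseteq> Z\<close> N by blast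
  ultimately have "C - Z = {}"
    using connectedD[OF C(2) \<open>open Z\<close>, of "C - Z"] by blast
  then show ?thesis using x Z by blast
qed

section \<open>Analytic maps near an attracting fixed point\<close>

locale attracting_fixed_point =
  fixes \<Omega> :: "(real ^ 'n) set" and f :: "real ^ 'n \<Rightarrow> real ^ 'n"
  assumes open_domain: "open \<Omega>" and zero_in_domain: "0 \<in> \<Omega>"
    and maps_into: "f ` \<Omega> \<subseteq> \<Omega>" and analytic: "real_analytic_on f \<Omega>"
    and fixed_zero: "f 0 = 0"
    and spectral: "matrix_spectral_radius (jacobian f (at 0)) < 1"
begin

lemma iterate_in_domain: "x \<in> \<Omega> \<Longrightarrow> (f ^^ k) x \<in> \<Omega>"
  using maps_into by (induction k) auto

lemma iterate_zero [simp]: "(f ^^ k) 0 = 0"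
  using fixed_zero by (induction k) auto

lemma iterate_analytic:
  assumes "a \<in> \<Omega>"
  shows "real_analytic_at (\<lambda>x. (f ^^ k) x $ i) a"
proof (induction k arbitrary: i)
  case 0
  show ?case by (simp add: real_analytic_at_coordinate)
next
  case (Suc k)
  have "real_analytic_at (\<lambda>x. f x $ i) ((f ^^ k) a)"
    using analytic iterate_in_domain[OF assms] real_analytic_at_component
    unfolding real_analytic_on_def by blast
  from real_analytic_at_compose[OF this Suc] show ?case by simp
qed

lemma iterate_isCont:
  assumes "a \<in> \<Omega>"
  shows "isCont (f ^^ k) a"
proof -
  have "isCont (\<lambda>x. (f ^^ k) x $ i) a" for i
    using real_analytic_at_isCont[OF iterate_analytic[OF assms]] .
  then show ?thesis unfolding isCont_def by (intro vec_tendstoI)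
qed

lemma iterate_derivative_at_zero:
  "((f ^^ m) has_derivative ((*v) (jacobian f (at 0)) ^^ m)) (at 0)"
proof (induction m)
  case 0
  show ?case by (simp add: id_def)
next
  case (Suc m)
  have "f differentiable (at 0)"
    using analytic zero_in_domain real_analytic_at_differentiable
    unfolding real_analytic_on_def by blast
  then have "(f has_derivative (*v) (jacobian f (at 0))) (at ((f ^^ m) 0))"
    by (simp add: jacobian_works)
  from diff_chain_at[OF Suc this] show ?case by (simp add: o_def)
qed

text \<open>
  For large \<open>m\<close> the derivative of \<open>f\<^sup>m\<close>, a power of the Jacobian matrix, has entries of size at most
  \<open>1 / (4 n)\<close>, so on the cube of radius \<open>s\<close> the linear part contributes at most \<open>s / 4\<close>. The remainder is
  \<open>O(s\<^sup>2)\<close> and contributes another \<open>s / 4\<close> for small \<open>s\<close>.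
\<close>

lemma some_iterate_halves:
  obtains m r where "0 < m" "0 < r"
    "\<And>s i. 0 < s \<Longrightarrow> s \<le> r \<Longrightarrow> majorized 0 s (s / 2) (\<lambda>x. (f ^^ m) x $ i)"
proof -
  define T where "T = (*v) (jacobian f (at 0))"
  define \<epsilon> where "\<epsilon> = 1 / (4 * real CARD('n))"
  have "0 < \<epsilon>" by (simp add: \<epsilon>_def)
  have "\<forall>\<^sub>F m in sequentially. norm ((T ^^ m) (axis j 1)) < \<epsilon>" for j :: 'n
    using tendstoD[OF matrix_powers_tendsto_zero[OF spectral] \<open>0 < \<epsilon>\<close>, of "axis j 1"]
    by (simp add: T_def dist_norm)
  then have "\<forall>\<^sub>F m in sequentially. \<forall>j. norm ((T ^^ m) (axis j 1)) < \<epsilon>"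
    by (rule eventually_all_finite)
  then have "\<forall>\<^sub>F m in sequentially. 0 < m \<and> (\<forall>j. norm ((T ^^ m) (axis j 1)) < \<epsilon>)"
    using eventually_gt_at_top[of 0] by eventually_elim auto
  then obtain m where "0 < m" and m: "\<And>j. norm ((T ^^ m) (axis j 1)) < \<epsilon>"
    by (auto simp: eventually_sequentially)
  have "\<exists>r>0. \<forall>s. 0 < s \<longrightarrow> s \<le> r \<longrightarrow> majorized 0 s (s / 2) (\<lambda>x. (f ^^ m) x $ i)" for i
  proof -
    obtain r M where maj: "majorized 0 r M (\<lambda>x. (f ^^ m) x $ i)"
      using iterate_analytic[OF zero_in_domain] real_analytic_at_iff_majorized by blast
    have r: "0 < r" and M: "0 \<le> M" using maj majorized_pos majorized_nonneg by auto
    obtain l where der: "((\<lambda>x. (f ^^ m) x $ i) has_derivative (\<lambda>h. \<Sum>j\<in>UNIV. l j * h $ j)) (at 0)"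
      and rest: "\<And>s. 0 < s \<Longrightarrow> s \<le> r \<Longrightarrow> majorized 0 s ((s / r)\<^sup>2 * M)
          (\<lambda>x. (f ^^ m) x $ i - (f ^^ m) 0 $ i - (\<Sum>j\<in>UNIV. l j * (x $ j - 0 $ j)))"
      by (rule majorized_derivative[OF maj]) (rule that)
    have "((\<lambda>x. (f ^^ m) x $ i) has_derivative (\<lambda>h. (T ^^ m) h $ i)) (at 0)"
      using bounded_linear.has_derivative[OF bounded_linear_vec_nth iterate_derivative_at_zero]
      by (simp add: T_def)
    from has_derivative_unique[OF der this]
    have "(\<Sum>j\<in>UNIV. l j * h $ j) = (T ^^ m) h $ i" for h by metis
    from this[of "axis _ 1"] have "l j = (T ^^ m) (axis j 1) $ i" for j
      by (simp add: axis_def if_distrib[where f="\<lambda>x. _ * x"] cong: if_cong)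
    then have l: "\<bar>l j\<bar> \<le> \<epsilon>" for j
      using m[of j] component_le_norm_cart[of "(T ^^ m) (axis j 1)" i] by simp
    have suml: "(\<Sum>j\<in>UNIV. \<bar>l j\<bar> * s) \<le> s / 4" if "0 < s" for s
    proof -
      have "(\<Sum>j\<in>UNIV. \<bar>l j\<bar> * s) \<le> (\<Sum>j\<in>(UNIV :: 'n set). \<epsilon> * s)"
        using l that by (intro sum_mono mult_right_mono) auto
      then show ?thesis by (simp add: \<epsilon>_def)
    qed
    \<comment> \<open>Chosen such that \<open>(s / r)\<^sup>2 * M \<le> s / 4\<close> for all \<open>s \<le> r'\<close>.\<close>
    define r' where "r' = min r (r\<^sup>2 / (4 * (M + 1)))"
    show ?thesis
    proof (intro exI[of _ r'] conjI allI impI)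
      show "0 < r'" using r M by (simp add: r'_def)
      fix s assume s: "0 < s" "s \<le> r'"
      have "s * (4 * (M + 1)) \<le> r\<^sup>2"
        using s M by (simp add: r'_def pos_le_divide_eq)
      then have "s * M \<le> r\<^sup>2 / 4" using s by (simp add: algebra_simps)
      then have "s * (s * M) \<le> s * (r\<^sup>2 / 4)" using s by (intro mult_left_mono) auto
      then have "(s / r)\<^sup>2 * M \<le> s / 4"
        using r by (simp add: power_divide divide_simps power2_eq_square mult_ac)
      moreover have "majorized 0 s (\<Sum>j\<in>UNIV. \<bar>l j\<bar> * s) (\<lambda>x. \<Sum>j\<in>UNIV. l j * (x $ j - 0 $ j))"
        using s by (intro majorized_sum majorized_cmult majorized_coordinate) auto
      ultimately have "majorized 0 s (s / 4 + s / 4)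
          (\<lambda>x. ((f ^^ m) x $ i - (f ^^ m) 0 $ i - (\<Sum>j\<in>UNIV. l j * (x $ j - 0 $ j)))
             + (\<Sum>j\<in>UNIV. l j * (x $ j - 0 $ j)))"
        using s suml[OF s(1)] rest[of s] by (intro majorized_add) (auto simp: r'_def intro: majorized_mono)
      then show "majorized 0 s (s / 2) (\<lambda>x. (f ^^ m) x $ i)" by simp
    qed
  qed
  then obtain r where r: "\<And>i. 0 < r i" "\<And>i s. 0 < s \<Longrightarrow> s \<le> r i \<Longrightarrow> majorized 0 s (s / 2) (\<lambda>x. (f ^^ m) x $ i)"
    by metis
  show ?thesis
  proof (rule that[OF \<open>0 < m\<close>, of "Min (range r)"])
    show "0 < Min (range r)" using r by simp
    show "majorized 0 s (s / 2) (\<lambda>x. (f ^^ m) x $ i)" if "0 < s" "s \<le> Min (range r)" for s i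
      using r(2)[of s i] that by simp
  qed
qed

text \<open>
  The central estimate. Iterating \<open>f\<^sup>m\<close> halves the majorant each time, because the halving holds on
  all smaller cubes too. The remaining \<open>k mod m\<close> applications of \<open>f\<close> cost only a bounded factor, and
  \<open>q = (1 / 2)\<^sup>1\<^sup>/\<^sup>m\<close> turns \<open>2\<close> to the power \<open>- (k div m)\<close> into a genuine geometric rate.
\<close>

lemma iterate_majorized:
  obtains C q r where "0 < C" "0 < q" "q < 1" "0 < r"
    "\<And>k i s. 0 < s \<Longrightarrow> s \<le> r \<Longrightarrow> majorized 0 s (C * q ^ k * s) (\<lambda>x. (f ^^ k) x $ i)"
proof -
  obtain m r1 where m: "0 < m" and r1: "0 < r1"
    and F: "\<And>s i. 0 < s \<Longrightarrow> s \<le> r1 \<Longrightarrow> majorized 0 s (s / 2) (\<lambda>x. (f ^^ m) x $ i)"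
    using some_iterate_halves by blast
  have Fk: "majorized 0 s (s / 2 ^ k) (\<lambda>x. ((f ^^ m) ^^ k) x $ i)" if "0 < s" "s \<le> r1" for s k i
  proof (induction k arbitrary: i)
    case 0
    show ?case using majorized_coordinate[OF that(1), of 0 i] by simp
  next
    case (Suc k)
    have "s / 2 ^ k \<le> s" using that by (simp add: divide_le_eq)
    then have "majorized 0 (s / 2 ^ k) (s / 2 ^ k / 2) (\<lambda>x. (f ^^ m) x $ i)"
      using that by (intro F) auto
    from majorized_compose[OF this, where h="(f ^^ m) ^^ k"] Suc
    show ?case by (simp add: mult.commute)
  qed
  obtain r2 M where r2: "0 < r2" "0 < M"
    and fj: "\<And>t s. t \<in> {..<m} \<times> (UNIV :: 'n set) \<Longrightarrow> 0 < s \<Longrightarrow> s \<le> r2 \<Longrightarrow>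
        majorized 0 s (M * s) (\<lambda>x. (f ^^ fst t) x $ snd t)"
    by (rule majorized_small_finite[of "{..<m} \<times> (UNIV :: 'n set)" "\<lambda>t x. (f ^^ fst t) x $ snd t" 0])
       (auto intro: iterate_analytic zero_in_domain)
  define q where "q = root m (1 / 2)"
  have q: "0 < q" "q < 1" "q ^ m = 1 / 2"
    using m by (auto simp: q_def real_root_pow_pos2)
  have half: "1 / 2 ^ (k div m) \<le> 2 * q ^ k" for k
  proof -
    have "q ^ k = q ^ (m * (k div m) + k mod m)" by simp
    also have "\<dots> = (1 / 2) ^ (k div m) * q ^ (k mod m)"
      by (simp only: power_add power_mult q)
    finally have "q ^ k = (1 / 2) ^ (k div m) * q ^ (k mod m)" .
    moreover have "q ^ m \<le> q ^ (k mod m)"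
      using q m by (intro power_decreasing) (auto simp: less_imp_le)
    then have "1 / 2 \<le> q ^ (k mod m)" using q(3) by simp
    ultimately have "(1 / 2) ^ (k div m) * (1 / 2) \<le> q ^ k" by simp
    then show ?thesis by (simp add: power_divide)
  qed
  show ?thesis
  proof (rule that[of "2 * M" q "min r1 r2"])
    fix k i s assume s: "0 < s" "s \<le> min r1 r2"
    define \<rho> where "\<rho> = s / 2 ^ (k div m)"
    have "\<rho> \<le> s" using s by (simp add: \<rho>_def divide_le_eq)
    then have \<rho>: "0 < \<rho>" "\<rho> \<le> r2" using s by (auto simp: \<rho>_def)
    have "majorized 0 \<rho> (M * \<rho>) (\<lambda>x. (f ^^ (k mod m)) x $ i)"
      using fj[of "(k mod m, i)"] \<rho> m by simp
    from majorized_compose[OF this, where h="(f ^^ m) ^^ (k div m)" and a=0 and r=s]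
    have "majorized 0 s (M * \<rho>) (\<lambda>x. (f ^^ (k mod m)) (((f ^^ m) ^^ (k div m)) x) $ i)"
      using Fk[of s "k div m"] s by (simp add: \<rho>_def)
    moreover have "(f ^^ (k mod m)) (((f ^^ m) ^^ (k div m)) x) = (f ^^ k) x" for x
      unfolding funpow_mult by (metis comp_apply funpow_add mod_mult_div_eq)
    moreover have "M * \<rho> \<le> 2 * M * q ^ k * s"
      using half[of k] r2 s mult_left_mono[of "1 / 2 ^ (k div m)" "2 * q ^ k" "M * s"]
      by (simp add: \<rho>_def mult_ac)
    ultimately show "majorized 0 s (2 * M * q ^ k * s) (\<lambda>x. (f ^^ k) x $ i)"
      using majorized_mono by simp
  qed (use q r1 r2 in auto)
qed

text \<open>
  The majorant on the smallest cube around \<open>0\<close> containing the Euclidean ball of radius \<open>\<parallel>x\<parallel>\<close> bounds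
  the orbit of \<open>x\<close>.
\<close>

lemma iterate_geometric_decay:
  obtains K q r where "0 < K" "0 < q" "q < 1" "0 < r"
    "\<And>k x. norm x \<le> r \<Longrightarrow> norm ((f ^^ k) x) \<le> K * q ^ k * norm x"
proof -
  obtain C q r where C: "0 < C" "0 < q" "q < 1" "0 < r"
    and m: "\<And>k i s. 0 < s \<Longrightarrow> s \<le> r \<Longrightarrow> majorized 0 s (C * q ^ k * s) (\<lambda>x. (f ^^ k) x $ i)"
    using iterate_majorized by blast
  show ?thesis
  proof (rule that[of "real CARD('n) * C" q r])
    fix k and x :: "real ^ 'n" assume x: "norm x \<le> r"
    show "norm ((f ^^ k) x) \<le> real CARD('n) * C * q ^ k * norm x"
    proof (cases "x = 0")
      case False
      then have s: "0 < norm x" by simp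
      have "x \<in> cube 0 (norm x)"
        using cball_subset_cube[of 0 "norm x"] by auto
      from majorized_abs_le[OF m[OF s x] this]
      have "(\<Sum>i\<in>UNIV. \<bar>(f ^^ k) x $ i\<bar>) \<le> (\<Sum>i\<in>(UNIV :: 'n set). C * q ^ k * norm x)"
        by (intro sum_mono)
      then show ?thesis using norm_le_l1_cart[of "(f ^^ k) x"] by simp
    qed simp
  qed (use C in auto)
qed

lemma asymptotically_stable: "asymptotically_stable_at_zero \<Omega> f"
proof -
  obtain K q r where K: "0 < K" "0 < q" "q < 1" "0 < r"
    and decay: "\<And>k x. norm x \<le> r \<Longrightarrow> norm ((f ^^ k) x) \<le> K * q ^ k * norm x"
    using iterate_geometric_decay by blast
  have "stable_at_zero \<Omega> f"
    unfolding stable_at_zero_def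
  proof (intro allI impI)
    fix e :: real assume "0 < e"
    show "\<exists>d>0. \<forall>x\<in>zero_ball \<Omega> d. \<forall>k. (f ^^ k) x \<in> zero_ball \<Omega> e"
    proof (intro exI[of _ "min r (e / K)"] conjI ballI allI)
      show "0 < min r (e / K)" using K \<open>0 < e\<close> by simp
      fix x k assume "x \<in> zero_ball \<Omega> (min r (e / K))"
      then have x: "x \<in> \<Omega>" "norm x \<le> r" "norm x * K < e"
        using K by (auto simp: zero_ball_def pos_less_divide_eq)
      have "K * q ^ k * norm x \<le> K * 1 * norm x"
        using K by (intro mult_right_mono mult_left_mono power_le_one) auto
      then have "norm ((f ^^ k) x) < e"
        using decay[OF x(2), of k] x(3) by (simp add: mult.commute)
      then show "(f ^^ k) x \<in> zero_ball \<Omega> e"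
        using x iterate_in_domain by (simp add: zero_ball_def)
    qed
  qed
  moreover have "(\<lambda>k. (f ^^ k) x) \<longlonglongrightarrow> 0" if "x \<in> zero_ball \<Omega> r" for x
  proof (rule tendsto_norm_zero_cancel, rule tendsto_sandwich[OF _ _ tendsto_const])
    have "(\<lambda>k. K * (q ^ k * norm x)) \<longlonglongrightarrow> K * (0 * norm x)"
      using K by (intro tendsto_intros LIMSEQ_power_zero) auto
    then show "(\<lambda>k. K * q ^ k * norm x) \<longlonglongrightarrow> 0" by (simp add: mult.assoc)
    show "\<forall>\<^sub>F k in sequentially. norm ((f ^^ k) x) \<le> K * q ^ k * norm x"
      using that by (intro always_eventually allI decay) (simp add: zero_ball_def)
  qed auto
  ultimately show ?thesis
    unfolding asymptotically_stable_at_zero_def using K by blast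
qed

abbreviation DA :: "(real ^ 'n) set" where
  "DA \<equiv> domain_of_attraction \<Omega> f"

lemma attracted_ball:
  obtains \<rho> where "0 < \<rho>" "\<And>x. x \<in> \<Omega> \<Longrightarrow> norm x < \<rho> \<Longrightarrow> x \<in> DA"
  using asymptotically_stable
  unfolding asymptotically_stable_at_zero_def zero_ball_def domain_of_attraction_def by blast

lemma iterate_in_DA_iff:
  assumes "x \<in> \<Omega>"
  shows "(f ^^ k) x \<in> DA \<longleftrightarrow> x \<in> DA"
proof -
  have "(\<lambda>j. (f ^^ j) ((f ^^ k) x)) = (\<lambda>j. (f ^^ (j + k)) x)"
    by (simp add: funpow_add)
  then show ?thesis
    using assms iterate_in_domain[OF assms] LIMSEQ_ignore_initial_segment[of "\<lambda>j. (f ^^ j) x" 0 k]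
      LIMSEQ_offset[of "\<lambda>j. (f ^^ j) x" k 0]
    by (auto simp: domain_of_attraction_def)
qed

lemma DA_enters_ball:
  assumes "x \<in> DA" "0 < e"
  obtains m where "norm ((f ^^ m) x) < e"
  using LIMSEQ_D[of "\<lambda>k. (f ^^ k) x" 0 e] assms by (auto simp: domain_of_attraction_def)

lemma zero_in_DA: "0 \<in> DA"
  using zero_in_domain by (simp add: domain_of_attraction_def)

text \<open>
  A point is attracted as soon as some iterate enters a small ball of attracted points, and this is an
  open condition.
\<close>

lemma open_DA: "open DA"
  unfolding open_subopen[of DA]
proof
  obtain \<rho> where \<rho>: "0 < \<rho>" "\<And>x. x \<in> \<Omega> \<Longrightarrow> norm x < \<rho> \<Longrightarrow> x \<in> DA" using attracted_ball by blast
  fix x assume x: "x \<in> DA"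
  then have "x \<in> \<Omega>" by (simp add: domain_of_attraction_def)
  obtain m where m: "norm ((f ^^ m) x) < \<rho>" using DA_enters_ball x \<rho> by blast
  have "continuous_on \<Omega> (\<lambda>y. norm ((f ^^ m) y))"
    using iterate_isCont by (intro continuous_on_norm continuous_at_imp_continuous_on) blast
  then have "open (\<Omega> \<inter> (\<lambda>y. norm ((f ^^ m) y)) -` {..<\<rho>})"
    using open_domain by (intro continuous_open_preimage) auto
  moreover have "\<Omega> \<inter> (\<lambda>y. norm ((f ^^ m) y)) -` {..<\<rho>} \<subseteq> DA"
    using \<rho>(2)[OF iterate_in_domain] iterate_in_DA_iff by blast
  ultimately show "\<exists>T. open T \<and> x \<in> T \<and> T \<subseteq> DA"
    using m \<open>x \<in> \<Omega>\<close> by (intro exI[of _ "\<Omega> \<inter> (\<lambda>y. norm ((f ^^ m) y)) -` {..<\<rho>}"]) auto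
qed

section \<open>The Lyapunov function\<close>

definition V :: "real ^ 'n \<Rightarrow> real" where
  "V x = (\<Sum>k. (norm ((f ^^ k) x))\<^sup>2)"

lemma summable_V:
  assumes "x \<in> DA"
  shows "summable (\<lambda>k. (norm ((f ^^ k) x))\<^sup>2)"
proof -
  obtain K q r where K: "0 < K" "0 < q" "q < 1" "0 < r"
    and decay: "\<And>k x. norm x \<le> r \<Longrightarrow> norm ((f ^^ k) x) \<le> K * q ^ k * norm x"
    using iterate_geometric_decay by blast
  obtain m where m: "norm ((f ^^ m) x) < r" using DA_enters_ball[OF assms K(4)] by blast
  have "summable (\<lambda>k. (norm ((f ^^ (k + m)) x))\<^sup>2)"
  proof (rule summable_comparison_test')
    have "q\<^sup>2 < 1" using K by (simp add: power_less_one_iff)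
    then show "summable (\<lambda>k. (K * norm ((f ^^ m) x))\<^sup>2 * (q\<^sup>2) ^ k)"
      using K by (intro summable_mult summable_geometric) auto
    fix k
    have "(norm ((f ^^ k) ((f ^^ m) x)))\<^sup>2 \<le> (K * q ^ k * norm ((f ^^ m) x))\<^sup>2"
      using decay m by (intro power_mono) auto
    then show "norm ((norm ((f ^^ (k + m)) x))\<^sup>2) \<le> (K * norm ((f ^^ m) x))\<^sup>2 * (q\<^sup>2) ^ k"
      by (simp add: funpow_add power_mult_distrib mult_ac flip: power_mult)
  qed
  then show ?thesis using summable_iff_shift by blast
qed

lemma V_split:
  assumes "x \<in> DA"
  shows "V x = V ((f ^^ m) x) + (\<Sum>k<m. (norm ((f ^^ k) x))\<^sup>2)"
  unfolding V_def using suminf_split_initial_segment[OF summable_V[OF assms], of m]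
  by (simp add: funpow_add)

lemma V_zero: "V 0 = 0"
  by (simp add: V_def)

lemma V_ge_partial_sum:
  assumes "x \<in> DA"
  shows "(\<Sum>k<m. (norm ((f ^^ k) x))\<^sup>2) \<le> V x"
  unfolding V_def by (intro sum_le_suminf summable_V assms) auto

lemma V_pos:
  assumes "x \<in> DA" "x \<noteq> 0"
  shows "0 < V x"
proof -
  have "(norm x)\<^sup>2 \<le> V x" using V_ge_partial_sum[OF assms(1), of 1] by simp
  then show ?thesis using assms(2) by (smt (verit) zero_less_norm_iff zero_less_power)
qed

lemma V_solves: "solves_functional_equation f DA V"
  unfolding solves_functional_equation_def
proof (intro conjI ballI)
  show "f ` DA \<subseteq> DA"
    using iterate_in_DA_iff[where k=1] by (auto simp: domain_of_attraction_def)
  show "V (f x) - V x = - (norm x)\<^sup>2" if "x \<in> DA" for x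
    using V_split[OF that, of 1] by simp
qed (simp_all add: zero_in_DA V_zero)

text \<open>
  Telescoping the equation for \<open>W\<close> along the orbit, which stays in \<open>U\<close>, leaves the remainder
  \<open>W (f\<^sup>k x)\<close>; it tends to \<open>W 0 = 0\<close> by continuity.
\<close>

lemma V_unique:
  assumes "solves_functional_equation f U W" "continuous (at 0 within U) W"
    and x: "x \<in> U" "x \<in> DA"
  shows "W x = V x"
proof -
  have fU: "f ` U \<subseteq> U" and W: "\<And>x. x \<in> U \<Longrightarrow> W (f x) - W x = - (norm x)\<^sup>2" and "W 0 = 0"
    using assms(1) by (auto simp: solves_functional_equation_def)
  have U: "(f ^^ k) x \<in> U" for k using fU x by (induction k) auto
  have "W x = W ((f ^^ k) x) + (\<Sum>j<k. (norm ((f ^^ j) x))\<^sup>2)" for k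
    using W[OF U] by (induction k) (auto simp: algebra_simps)
  moreover have "(\<lambda>k. W ((f ^^ k) x)) \<longlonglongrightarrow> W 0"
    using continuous_within_tendsto_compose'[OF assms(2), of "\<lambda>k. (f ^^ k) x"] U x
    by (auto simp: domain_of_attraction_def)
  then have "(\<lambda>k. W ((f ^^ k) x) + (\<Sum>j<k. (norm ((f ^^ j) x))\<^sup>2)) \<longlonglongrightarrow> 0 + V x"
    unfolding V_def using summable_LIMSEQ[OF summable_V[OF x(2)]] \<open>W 0 = 0\<close>
    by (intro tendsto_add) auto
  ultimately show ?thesis by (simp add: LIMSEQ_const_iff)
qed

lemma norm_power2_eq_sum: "(norm x)\<^sup>2 = (\<Sum>i\<in>UNIV. (x $ i)\<^sup>2)" for x :: "real ^ 'n"
  by (simp add: norm_vec_def L2_set_def sum_nonneg)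

text \<open>
  The squares of the components of the iterates have bounds that form a convergent geometric series.
\<close>

lemma V_majorized_near_zero:
  obtains r M where "majorized 0 r M V"
proof -
  obtain C q r where C: "0 < C" "0 < q" "q < 1" "0 < r"
    and m: "\<And>k i s. 0 < s \<Longrightarrow> s \<le> r \<Longrightarrow> majorized 0 s (C * q ^ k * s) (\<lambda>x. (f ^^ k) x $ i)"
    using iterate_majorized by blast
  define g where "g k x = (\<Sum>i\<in>UNIV. ((f ^^ k) x $ i)\<^sup>2)" for k x
  define B where "B k = (\<Sum>i\<in>(UNIV :: 'n set). (C * q ^ k * r)\<^sup>2)" for k
  have B: "B k = real CARD('n) * (C * r)\<^sup>2 * (q\<^sup>2) ^ k" for k
    by (simp add: B_def power_mult_distrib mult_ac flip: power_mult)
  have "q\<^sup>2 < 1" using C by (simp add: power_less_one_iff)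
  then have "summable B"
    unfolding B using C by (intro summable_mult summable_geometric) auto
  then have "B summable_on UNIV"
    by (subst summable_on_UNIV_nonneg_real_iff) (auto simp: B_def intro: sum_nonneg)
  then have Bs: "(B has_sum infsum B UNIV) UNIV" by simp
  have g: "majorized 0 r (B k) (g k)" if "k \<in> UNIV" for k
    unfolding g_def B_def using C m by (intro majorized_sum majorized_power) auto
  have "majorized 0 r (infsum B UNIV) V"
  proof (rule majorized_cong[OF majorized_infsum(1)[OF C(4) g Bs]])
    fix x :: "real ^ 'n" assume "x \<in> cube 0 r"
    from majorized_infsum(2)[OF C(4) g Bs this]
    have "((\<lambda>k. g k x) has_sum infsum (\<lambda>k. g k x) UNIV) UNIV" by simp
    then have "(\<lambda>k. g k x) sums infsum (\<lambda>k. g k x) UNIV" by (rule has_sum_imp_sums)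
    then show "infsum (\<lambda>k. g k x) UNIV = V x"
      by (simp add: V_def norm_power2_eq_sum g_def sums_iff)
  qed
  then show ?thesis using that by blast
qed

lemma V_analytic: "real_analytic_on V DA"
  unfolding real_analytic_on_def
proof
  fix a assume a: "a \<in> DA"
  then have a\<Omega>: "a \<in> \<Omega>" by (simp add: domain_of_attraction_def)
  obtain r M where m: "majorized 0 r M V" using V_majorized_near_zero by blast
  have r: "0 < r" using m majorized_pos by blast
  obtain k where k: "norm ((f ^^ k) a) < r / 2" using DA_enters_ball[OF a, of "r / 2"] r by auto
  have "(f ^^ k) a \<in> cube 0 (r - r / 2)"
    using cball_subset_cube[of 0 "r - r / 2"] k by auto
  then have "majorized ((f ^^ k) a) (r / 2) M V"
    using r by (intro majorized_recenter[OF m]) auto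
  then have "real_analytic_at V ((f ^^ k) a)"
    using real_analytic_at_iff_majorized by blast
  from real_analytic_at_compose[OF this iterate_analytic[OF a\<Omega>]]
  have "real_analytic_at (\<lambda>x. V ((f ^^ k) x) + (\<Sum>j<k. \<Sum>i\<in>UNIV. ((f ^^ j) x $ i)\<^sup>2)) a"
    by (intro real_analytic_at_add real_analytic_at_sum real_analytic_at_power iterate_analytic a\<Omega>)
  then show "real_analytic_at V a"
    by (rule real_analytic_at_cong_open[OF _ open_DA a])
       (simp add: V_split[where m=k] norm_power2_eq_sum)
qed

text \<open>
  No iterate of \<open>x0\<close> lies in the ball of radius \<open>\<rho>\<close> of attracted points, since otherwise \<open>x0\<close> itself
  would be attracted. So the sum of the first \<open>N\<close> terms is at least \<open>N * \<rho>\<^sup>2\<close> at \<open>x0\<close>, and by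
  continuity it exceeds any smaller number near \<open>x0\<close>.
\<close>

lemma V_tendsto_infinity:
  assumes x0: "x0 \<in> \<Omega>" "x0 \<in> frontier DA"
  shows "filterlim V at_top (at x0 within DA)"
  unfolding filterlim_at_top
proof
  fix Z :: real
  obtain \<rho> where \<rho>: "0 < \<rho>" "\<And>x. x \<in> \<Omega> \<Longrightarrow> norm x < \<rho> \<Longrightarrow> x \<in> DA" using attracted_ball by blast
  have "x0 \<notin> DA" using x0(2) open_DA by (simp add: frontier_def interior_open)
  then have far: "\<rho> \<le> norm ((f ^^ k) x0)" for k
    using \<rho>(2)[OF iterate_in_domain[OF x0(1)]] iterate_in_DA_iff[OF x0(1)] by (meson not_le)
  obtain N :: nat where N: "Z < real N * \<rho>\<^sup>2"
    using reals_Archimedean3[of "\<rho>\<^sup>2"] \<rho>(1) by auto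
  have "isCont (\<lambda>x. \<Sum>k<N. (norm ((f ^^ k) x))\<^sup>2) x0"
    using iterate_isCont[OF x0(1)] by (intro continuous_intros)
  moreover have "real N * \<rho>\<^sup>2 \<le> (\<Sum>k<N. (norm ((f ^^ k) x0))\<^sup>2)"
  proof -
    have "(\<Sum>k<N. \<rho>\<^sup>2) \<le> (\<Sum>k<N. (norm ((f ^^ k) x0))\<^sup>2)"
      by (rule sum_mono) (use far \<rho>(1) in \<open>auto intro: power_mono\<close>)
    then show ?thesis by simp
  qed
  ultimately have "\<forall>\<^sub>F x in at x0. Z < (\<Sum>k<N. (norm ((f ^^ k) x))\<^sup>2)"
    using N unfolding isCont_def
    by (intro order_tendstoD(1)[where y="\<Sum>k<N. (norm ((f ^^ k) x0))\<^sup>2"]) auto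
  then have "\<forall>\<^sub>F x in at x0 within DA. Z < (\<Sum>k<N. (norm ((f ^^ k) x))\<^sup>2)"
    by (rule filter_leD[OF at_le[OF subset_UNIV]])
  moreover have "\<forall>\<^sub>F x in at x0 within DA. x \<in> DA"
    by (simp add: eventually_at_filter)
  ultimately show "\<forall>\<^sub>F x in at x0 within DA. Z \<le> V x"
    by eventually_elim (use V_ge_partial_sum in \<open>smt (verit)\<close>)
qed

text \<open>
  A continuation \<open>W\<close> agrees with \<open>V\<close> on a component \<open>C\<close> of \<open>U \<inter> DA\<close>. If \<open>C\<close> were not all of \<open>U\<close>, then
  connectedness of \<open>U\<close> would give a boundary point \<open>x0\<close> of \<open>C\<close> in \<open>U\<close>. By maximality of the component it
  lies outside \<open>DA\<close>, so \<open>V\<close> blows up along \<open>C\<close> at \<open>x0\<close>, although \<open>W\<close> is continuous there.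
\<close>

lemma V_natural_domain: "natural_domain_of_analyticity \<Omega> V DA"
  unfolding natural_domain_of_analyticity_def
proof (intro conjI allI impI)
  show "DA \<subseteq> \<Omega>" by (auto simp: domain_of_attraction_def)
  fix U N W
  assume "open U \<and> connected U \<and> U \<subseteq> \<Omega> \<and> open N \<and> N \<noteq> {} \<and> N \<subseteq> U \<inter> DA \<and>
      real_analytic_on W U \<and> (\<forall>x\<in>N. W x = V x)"
  then have U: "open U" "connected U" "U \<subseteq> \<Omega>" and N: "open N" "N \<noteq> {}" "N \<subseteq> U \<inter> DA"
    and W: "real_analytic_on W U" and WV: "\<And>x. x \<in> N \<Longrightarrow> W x = V x" by auto
  obtain p where p: "p \<in> N" using N by blast
  define C where "C = connected_component_set (U \<inter> DA) p"
  have UD: "open (U \<inter> DA)" using U open_DA by blast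
  have C: "open C" "connected C" "C \<subseteq> U \<inter> DA" "p \<in> C"
    using UD p N by (auto simp: C_def open_connected_component connected_component_subset connected_component_refl_eq
        dest: connected_component_in)
  have "W x - V x = 0" if "x \<in> C" for x
  proof (rule real_analytic_on_eq_zero[OF C(1,2) _ _ _ _ _ that, where N="C \<inter> N"])
    show "real_analytic_on (\<lambda>x. W x - V x) C"
      using W V_analytic C(3) unfolding real_analytic_on_def by (blast intro: real_analytic_at_diff)
  qed (use C p N WV in auto)
  then have WC: "W x = V x" if "x \<in> C" for x using that by fastforce
  have "U \<subseteq> C"
  proof (rule ccontr)
    assume "\<not> U \<subseteq> C"
    then have "U \<inter> C \<noteq> {}" "U - C \<noteq> {}" using C by auto
    then obtain x0 where x0: "x0 \<in> U" "x0 \<in> frontier C"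
      using connected_Int_frontier[OF U(2)] by blast
    have x0C: "x0 \<notin> C" "x0 \<in> closure C" using x0(2) C(1) by (auto simp: frontier_def interior_open)
    have "x0 \<notin> DA"
    proof
      assume "x0 \<in> DA"
      then obtain e where e: "0 < e" "ball x0 e \<subseteq> U \<inter> DA"
        using UD x0 open_contains_ball by blast
      obtain y where y: "y \<in> C" "y \<in> ball x0 e"
        using closure_approachable[THEN iffD1, OF x0C(2)] e(1) by (auto simp: dist_commute)
      have "connected (C \<union> ball x0 e)" using C y by (intro connected_Un) auto
      then have "C \<union> ball x0 e \<subseteq> C"
        using C e unfolding C_def by (intro connected_component_maximal) auto
      moreover have "x0 \<in> ball x0 e" using e by simp
      ultimately show False using x0C by blast
    qed
    then have "x0 \<in> frontier DA"
      using x0C C(3) open_DA closure_mono[of C DA] by (auto simp: frontier_def interior_open)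
    then have "filterlim V at_top (at x0 within DA)"
      using x0 U V_tendsto_infinity by blast
    then have lim: "filterlim V at_top (at x0 within C)"
      by (rule filterlim_mono) (use C in \<open>auto intro: at_le\<close>)
    have "\<forall>\<^sub>F x in at x0 within C. x \<in> C" by (simp add: eventually_at_filter)
    then have "\<forall>\<^sub>F x in at x0 within C. V x = W x" by eventually_elim (simp add: WC)
    then have "filterlim W at_top (at x0 within C)" using lim filterlim_cong by fast
    moreover have "(W \<longlongrightarrow> W x0) (at x0 within C)"
      using real_analytic_at_isCont W x0(1) unfolding real_analytic_on_def isCont_def
      by (meson at_le subset_UNIV tendsto_mono)
    moreover have "at x0 within C \<noteq> bot"
      using x0C by (simp add: trivial_limit_within islimpt_in_closure)
    ultimately show False
      using not_tendsto_and_filterlim_at_infinity filterlim_at_top_imp_at_infinity by blast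
  qed
  then show "U \<subseteq> DA" using C by blast
qed (use open_DA V_analytic in auto)

end

theorem theorem1:
  fixes \<Omega> :: "(real ^ 'n) set" and f :: "real ^ 'n \<Rightarrow> real ^ 'n"
  assumes "open \<Omega>" and "connected \<Omega>" and "0 \<in> \<Omega>"
    and "f ` \<Omega> \<subseteq> \<Omega>" and "real_analytic_on f \<Omega>"
    and "f 0 = 0"
    and "matrix_spectral_radius (jacobian f (at 0)) < 1"
  shows "asymptotically_stable_at_zero \<Omega> f \<and>
    open (domain_of_attraction \<Omega> f) \<and> domain_of_attraction \<Omega> f \<subseteq> \<Omega> \<and>
    (\<exists>V :: real ^ 'n \<Rightarrow> real.
       solves_functional_equation f (domain_of_attraction \<Omega> f) V \<and>
       (\<forall>U W. U \<subseteq> \<Omega> \<and> solves_functional_equation f U W \<and> continuous (at 0 within U) W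
          \<longrightarrow> (\<forall>x \<in> U \<inter> domain_of_attraction \<Omega> f. W x = V x)) \<and>
       natural_domain_of_analyticity \<Omega> V (domain_of_attraction \<Omega> f) \<and>
       (\<forall>x \<in> domain_of_attraction \<Omega> f - {0}. V x > 0) \<and>
       (\<forall>x0 \<in> \<Omega> \<inter> frontier (domain_of_attraction \<Omega> f).
          filterlim V at_top (at x0 within domain_of_attraction \<Omega> f)))"
proof -
  interpret attracting_fixed_point \<Omega> f
    using assms by unfold_locales
  show ?thesis
  proof (intro conjI)
    show "domain_of_attraction \<Omega> f \<subseteq> \<Omega>" by (auto simp: domain_of_attraction_def)
  qed (use asymptotically_stable open_DA V_solves V_unique V_natural_domain V_pos V_tendsto_infinity in blast)+
qed

end
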